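(* Let $A$ be a finite-dimensional semisimple associative algebra over a field $F$ with $\mathrm{char}(F)\neq 2,3$, and let $Z$ be the center of $A$. For a linear map $T:A\to A$ the following are equivalent: (i) $T(x)^3-x^3\in[A,A]$ for every $x\in A$; (ii) there exist a Jordan automorphism $J$ of $A$ belonging to the multiplication algebra $M(A)$ and an element $\alpha\in Z$ with $\alpha^3=1$ such that $T(x)=\alpha J(x)$ for all $x\in A$.
   Context: $[A,A]$ denotes the linear span of all commutators $xy-yx$, $x,y\in A$. A Jordan automorphism of $A$ is a bijective linear map $J:A\to A$ with $J(xy+yx)=J(x)J(y)+J(y)J(x)$ for all $x,y\in A$. The multiplication algebra $M(A)$ is the algebra of all linear maps $A\to A$ of the form $x\mapsto\sum_i a_ixb_i$ (finite sums) with $a_i,b_i\in A$. *)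

theory Defs
  imports Complex_Main
begin

definition is_algebra :: "('k::field \<Rightarrow> 'a::ring_1 \<Rightarrow> 'a) \<Rightarrow> bool" where
  "is_algebra scale \<longleftrightarrow> vector_space scale \<and>
     (\<forall>c x y. scale c (x * y) = scale c x * y \<and> scale c (x * y) = x * scale c y)"

definition fin_dim_algebra :: "('k::field \<Rightarrow> 'a::ring_1 \<Rightarrow> 'a) \<Rightarrow> bool" where
  "fin_dim_algebra scale \<longleftrightarrow> is_algebra scale \<and>
     (\<exists>B. finite B \<and> module.span scale B = UNIV)"

definition alg_ideal :: "('k::field \<Rightarrow> 'a::ring_1 \<Rightarrow> 'a) \<Rightarrow> 'a set \<Rightarrow> bool" where
  "alg_ideal scale I \<longleftrightarrow> module.subspace scale I \<and> (\<forall>a\<in>I. \<forall>x. x * a \<in> I \<and> a * x \<in> I)"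

definition nilpotent_set :: "'a::ring_1 set \<Rightarrow> bool" where
  "nilpotent_set I \<longleftrightarrow> (\<exists>n>0. \<forall>xs. length xs = n \<and> set xs \<subseteq> I \<longrightarrow> prod_list xs = 0)"

text \<open>Semisimple (finite-dimensional) algebra: the radical is zero, i.e. there is no nonzero nilpotent ideal.\<close>
definition semisimple_algebra :: "('k::field \<Rightarrow> 'a::ring_1 \<Rightarrow> 'a) \<Rightarrow> bool" where
  "semisimple_algebra scale \<longleftrightarrow> is_algebra scale \<and>
     (\<forall>I. alg_ideal scale I \<and> nilpotent_set I \<longrightarrow> I = {0})"

definition center :: "'a::ring_1 set" where
  "center = {z. \<forall>x. z * x = x * z}"

definition commutator_span :: "('k::field \<Rightarrow> 'a::ring_1 \<Rightarrow> 'a) \<Rightarrow> 'a set" where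
  "commutator_span scale = module.span scale {x * y - y * x | x y. True}"

definition jordan_automorphism :: "('k::field \<Rightarrow> 'a::ring_1 \<Rightarrow> 'a) \<Rightarrow> ('a \<Rightarrow> 'a) \<Rightarrow> bool" where
  "jordan_automorphism scale J \<longleftrightarrow> Vector_Spaces.linear scale scale J \<and> bij J \<and>
     (\<forall>x y. J (x * y + y * x) = J x * J y + J y * J x)"

definition in_mult_algebra :: "('a::ring_1 \<Rightarrow> 'a) \<Rightarrow> bool" where
  "in_mult_algebra f \<longleftrightarrow> (\<exists>n a b. \<forall>x. f x = (\<Sum>i<(n::nat). a i * x * b i))"

end

(* Write x ~ y for x - y in [A,A] and o for the symmetrised product xy + yx.

   A is handled without Wedderburn's theorem or scalar extension. Separating functionals A -> Z
   inside M(A) give a dual basis of A over Z, hence End_Z(A) = M(A) and a Z-valued trace on M(A).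
   This trace shows that the form (x, y) |-> xy mod [A,A] is nondegenerate, also when
   the characteristic divides the degree of A.

   A Jordan automorphism J in M(A) satisfies J(x) ~ x: by Peirce decomposition it suffices to take
   x in a corner fAf that is a division ring. There J(x) corresponds to an element with the same
   minimal polynomial as x over the center, hence to a conjugate of x.

   Conversely, polarising (i) gives (T(x) o T(y)) T(z) ~ (x o y) z. By nondegeneracy T is bijective
   and Z-linear, and 2 T(x) o T(y) = a o T(x o y) for a = T(1). The heart of the matter is that
   a is central; then J = a^-1 T is a Jordan automorphism in M(A), and J(x) ~ x forces a^3 = 1. *)
theory Submission
  imports Defs
begin

section \<open>The multiplication algebra\<close>

text \<open>Z may be an inseparable extension of the ground field, so extending scalars could
  destroy semisimplicity; hence the linear algebra is done over Z. As Z is in general a product of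
  fields, inverses are replaced by elements z' with z z' z = z, and bases by dual bases.

  Centrality of a needs two mechanisms. For an idempotent g, the elements T(g) and T(1-g)
  anticommute and have sum a; as w |-> a o w is injective, this forces them to commute with a. That
  controls every part of A with non-central idempotents. A division summand offers no such
  idempotents, and there an identity for the inner derivation C by a has to serve. Mere nilpotence
  of C would not do: in characteristic p, C^p = 0 holds as soon as a^p is central. The exponent 4
  supplied by Newton's identity is small enough, since 4! is invertible away from characteristics 2
  and 3.\<close>

inductive mult_map :: "('a::ring_1 \<Rightarrow> 'a) \<Rightarrow> bool" where
  mult_map_base: "mult_map (\<lambda>x. a * x * b)"
| mult_map_add: "mult_map f \<Longrightarrow> mult_map g \<Longrightarrow> mult_map (\<lambda>x. f x + g x)"

lemma mult_map_left: "mult_map (\<lambda>x. a * x)"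
  using mult_map_base[of a 1] by simp

lemma mult_map_right: "mult_map (\<lambda>x. x * a)"
  using mult_map_base[of 1 a] by simp

lemma mult_map_id: "mult_map (\<lambda>x. x)"
  using mult_map_base[of 1 1] by simp

lemma mult_map_zero: "mult_map (\<lambda>x. 0)"
  using mult_map_base[of 0 0] by simp

lemma mult_map_comp:
  assumes "mult_map f" "mult_map g"
  shows "mult_map (\<lambda>x. f (g x))"
  using assms(1)
proof induction
  case (mult_map_base a b)
  show ?case using assms(2)
  proof induction
    case (mult_map_base c d)
    show ?case using mult_map.mult_map_base[of "a * c" "d * b"] by (simp add: mult.assoc)
  next
    case (mult_map_add f g)
    then show ?case using mult_map.mult_map_add[OF mult_map_add.IH] by (simp add: algebra_simps)
  qed
next
  case (mult_map_add f g)
  then show ?case using mult_map.mult_map_add by blast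
qed

lemma mult_map_diff:
  assumes "mult_map f" "mult_map g"
  shows "mult_map (\<lambda>x. f x - g x)"
  using mult_map_add[OF assms(1) mult_map_comp[OF mult_map_left[of "-1"] assms(2)]] by simp

lemma mult_map_sum:
  assumes "\<And>i. i \<in> I \<Longrightarrow> mult_map (f i)"
  shows "mult_map (\<lambda>x. \<Sum>i\<in>I. f i x)"
  using assms by (induction I rule: infinite_finite_induct) (simp_all add: mult_map_zero mult_map_add)

text \<open>The inductive form allows induction over the summands; this links it to the indexed sums
  of the statement.\<close>

lemma mult_map_iff: "mult_map f \<longleftrightarrow> in_mult_algebra f"
proof
  assume "mult_map f"
  then show "in_mult_algebra f"
  proof induction
    case (mult_map_base a b)
    show ?case unfolding in_mult_algebra_def
      by (rule exI[of _ 1], rule exI[of _ "\<lambda>_. a"], rule exI[of _ "\<lambda>_. b"]) simp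
  next
    case (mult_map_add f g)
    obtain n a b where f: "\<And>x. f x = (\<Sum>i<(n::nat). a i * x * b i)"
      using mult_map_add.IH(1) unfolding in_mult_algebra_def by blast
    obtain m c d where g: "\<And>x. g x = (\<Sum>i<(m::nat). c i * x * d i)"
      using mult_map_add.IH(2) unfolding in_mult_algebra_def by blast
    define a' where "a' = (\<lambda>i. if i < n then a i else c (i - n))"
    define b' where "b' = (\<lambda>i. if i < n then b i else d (i - n))"
    have split: "(\<Sum>i<n + k. h i) = (\<Sum>i<n. h i) + (\<Sum>i<k. h (n + i))" for h :: "nat \<Rightarrow> 'a" and k
      by (induction k) (simp_all add: add.assoc)
    have "f x + g x = (\<Sum>i<n + m. a' i * x * b' i)" for x
      unfolding split f g a'_def b'_def by simp
    then show ?case unfolding in_mult_algebra_def by blast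
  qed
next
  assume "in_mult_algebra f"
  then obtain n a b where f: "\<And>x. f x = (\<Sum>i<(n::nat). a i * x * b i)"
    unfolding in_mult_algebra_def by blast
  have "mult_map (\<lambda>x. \<Sum>i<n. a i * x * b i)" by (intro mult_map_sum mult_map_base)
  then show "mult_map f" by (simp add: f[abs_def])
qed

lemma centerD: "z \<in> center \<Longrightarrow> z * x = x * z"
  by (simp add: center_def)

lemma centerI: "(\<And>x. z * x = x * z) \<Longrightarrow> z \<in> center"
  by (simp add: center_def)

lemma center_mult: "z \<in> center \<Longrightarrow> w \<in> center \<Longrightarrow> z * w \<in> center"
  by (rule centerI) (metis centerD mult.assoc)

lemma center_one: "1 \<in> center"
  by (simp add: center_def)

lemma mult_map_center:
  assumes "mult_map f" "z \<in> center"
  shows "f (z * x) = z * f x"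
  using assms(1)
proof induction
  case (mult_map_base a b)
  have "a * (z * x) = z * (a * x)"
    by (simp only: mult.assoc[symmetric] centerD[OF assms(2), of a])
  then show ?case by (simp add: mult.assoc)
qed (simp add: algebra_simps)

lemma mult_map_plus: "mult_map f \<Longrightarrow> f (x + y) = f x + f y"
  by (induction rule: mult_map.induct) (simp_all add: algebra_simps)

lemma mult_map_zero_arg: "mult_map f \<Longrightarrow> f 0 = 0"
  by (induction rule: mult_map.induct) simp_all

lemma mult_map_sum_arg: "mult_map f \<Longrightarrow> f (\<Sum>i\<in>I. g i) = (\<Sum>i\<in>I. f (g i))"
  by (induction I rule: infinite_finite_induct) (simp_all add: mult_map_plus mult_map_zero_arg)

section \<open>Extremal subspaces and ideals in finite dimension\<close>

locale fd_algebra = finite_dimensional_vector_space scale Basis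
  for scale :: "'k::field \<Rightarrow> 'a::ring_1 \<Rightarrow> 'a" and Basis :: "'a set" +
  assumes scale_mult_left: "scale c (x * y) = scale c x * y"
    and scale_mult_right: "scale c (x * y) = x * scale c y"
begin

lemma mult_map_scale: "mult_map f \<Longrightarrow> f (scale c x) = scale c (f x)"
  by (induction rule: mult_map.induct)
    (simp_all add: scale_mult_left[symmetric] scale_mult_right[symmetric] scale_right_distrib)

lemma ker_subspace: "mult_map f \<Longrightarrow> subspace {x :: 'a. f x = 0}"
  by (rule subspaceI) (simp_all add: mult_map_plus mult_map_scale mult_map_zero_arg)

text \<open>Bounded dimension replaces Zorn's lemma: the extremal kernels, right ideals and
  idempotents chosen later come from this lemma and its dual.\<close>

lemma maximal_subspace:
  assumes "P V0" "\<And>V. P V \<Longrightarrow> subspace V"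
  obtains V where "P V" "\<And>W. P W \<Longrightarrow> V \<subseteq> W \<Longrightarrow> W = V"
proof -
  have "\<And>V. P V \<Longrightarrow> dim V < dim (UNIV :: 'a set) + 1"
    using dim_subset[OF subset_UNIV] by (simp only: Suc_eq_plus1[symmetric] less_Suc_eq_le)
  then obtain V where V: "P V" "\<And>W. P W \<Longrightarrow> dim W \<le> dim V"
    using ex_has_greatest_nat[of P V0 dim "dim (UNIV :: 'a set) + 1"] assms(1)
    by (metis less_imp_le_nat)
  show thesis
  proof (rule that[OF V(1)])
    fix W assume "P W" "V \<subseteq> W"
    then show "W = V"
      using subspace_dim_equal[of V W] V assms(2) by blast
  qed
qed

lemma minimal_subspace:
  assumes "P V0" "\<And>V. P V \<Longrightarrow> subspace V"
  obtains V where "P V" "\<And>W. P W \<Longrightarrow> W \<subseteq> V \<Longrightarrow> W = V"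
proof -
  obtain V where V: "P V" "\<And>W. P W \<Longrightarrow> dim V \<le> dim W"
    using ex_has_least_nat[of P V0 dim] assms(1) by blast
  show thesis
  proof (rule that[OF V(1)])
    fix W assume "P W" "W \<subseteq> V"
    then show "W = V"
      using subspace_dim_equal[of W V] V assms(2) by blast
  qed
qed

definition right_ideal :: "'a set \<Rightarrow> bool" where
  "right_ideal R \<longleftrightarrow> subspace R \<and> (\<forall>x\<in>R. \<forall>y. x * y \<in> R)"

lemma right_ideal_mult_image:
  assumes "right_ideal R"
  shows "right_ideal ((*) x ` R)"
  unfolding right_ideal_def
proof (intro conjI ballI allI)
  have R: "subspace R" using assms by (simp add: right_ideal_def)
  show "subspace ((*) x ` R)"
  proof (rule subspaceI)
    show "0 \<in> (*) x ` R" using subspace_0[OF R] by (metis image_eqI mult_zero_right)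
    show "\<And>u v. u \<in> (*) x ` R \<Longrightarrow> v \<in> (*) x ` R \<Longrightarrow> u + v \<in> (*) x ` R"
      using subspace_add[OF R] by (auto simp: distrib_left[symmetric])
    show "\<And>c u. u \<in> (*) x ` R \<Longrightarrow> scale c u \<in> (*) x ` R"
      using subspace_scale[OF R] by (auto simp: scale_mult_right)
  qed
  show "u * y \<in> (*) x ` R" if "u \<in> (*) x ` R" for u y
    using that assms by (auto simp: right_ideal_def mult.assoc)
qed

lemma range_mult_subspace: "subspace (range ((*) (x :: 'a)))"
  using right_ideal_mult_image[of UNIV x] by (simp add: right_ideal_def)

definition ideal :: "'a set \<Rightarrow> bool" where
  "ideal I \<longleftrightarrow> subspace I \<and> (\<forall>x\<in>I. \<forall>y. x * y \<in> I \<and> y * x \<in> I)"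

text \<open>Each element of the two-sided ideal generated by \<open>v\<close> is thus the value at
  \<open>v\<close> of a map in M(A), so the unit of that ideal is reached by such a map.\<close>

lemma generated_ideal:
  fixes v :: 'a
  shows "ideal {m v | m. mult_map m}"
proof -
  define I where "I = {m v | m. mult_map m}"
  have I: "m v \<in> I" if "mult_map m" for m using that I_def by blast
  have "ideal I"
    unfolding ideal_def
  proof (intro conjI ballI allI subspaceI)
    show "0 \<in> I" using I[OF mult_map_zero] .
  next
    fix x y assume "x \<in> I" "y \<in> I"
    then obtain m m' where "x = m v" "mult_map m" "y = m' v" "mult_map m'" unfolding I_def by blast
    then show "x + y \<in> I" using I[OF mult_map_add[of m m']] by simp
  next
    fix c x assume "x \<in> I"
    then obtain m where "x = m v" "mult_map m" unfolding I_def by blast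
    then show "scale c x \<in> I"
      using I[OF mult_map_comp[OF mult_map_left[of "scale c 1"]], of m]
      by (simp add: scale_mult_left[symmetric])
  next
    fix x y assume "x \<in> I"
    then obtain m where "x = m v" "mult_map m" unfolding I_def by blast
    then show "x * y \<in> I" "y * x \<in> I"
      using I[OF mult_map_comp[OF mult_map_left[of y]], of m]
        I[OF mult_map_comp[OF mult_map_right[of y]], of m] by simp_all
  qed
  then show ?thesis by (simp only: I_def)
qed

end

section \<open>Idempotents, central units and coordinates over the center\<close>

locale semiprime_algebra = fd_algebra scale Basis
  for scale :: "'k::field \<Rightarrow> 'a::ring_1 \<Rightarrow> 'a" and Basis :: "'a set" +
  assumes semiprime: "(\<And>y. x * y * x = 0) \<Longrightarrow> x = (0::'a)"
begin

text \<open>Brauer's lemma. In a minimal right ideal I with xI nonzero, minimality gives xI = I and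
  makes the annihilator of x in I trivial; so x g = x with g in I forces g g = g.\<close>

lemma right_ideal_idempotent:
  assumes "right_ideal R" "R \<noteq> {0}"
  obtains g where "g \<in> R" "g \<noteq> 0" "g * g = g"
proof -
  obtain I where I: "right_ideal I" "I \<noteq> {0}" "I \<subseteq> R"
    and minI: "\<And>W. right_ideal W \<and> W \<noteq> {0} \<and> W \<subseteq> R \<Longrightarrow> W \<subseteq> I \<Longrightarrow> W = I"
    using minimal_subspace[of "\<lambda>W. right_ideal W \<and> W \<noteq> {0} \<and> W \<subseteq> R" R] assms
    by (metis order_refl right_ideal_def)
  have subI: "subspace I" and mulI: "\<And>x y. x \<in> I \<Longrightarrow> x * y \<in> I"
    using I by (auto simp: right_ideal_def)
  obtain u where u: "u \<in> I" "u \<noteq> 0" using I(2) subspace_0[OF subI] by blast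
  obtain y where y: "u * y * u \<noteq> 0" using semiprime u(2) by blast
  define x where "x = u * y"
  have x: "x \<in> I" using u mulI x_def by simp
  have "(*) x ` I \<subseteq> I" using mulI[OF x] by auto
  moreover have "(*) x ` I \<noteq> {0}" using y u(1) unfolding x_def by blast
  ultimately have xI: "(*) x ` I = I"
    using minI[of "(*) x ` I"] right_ideal_mult_image[OF I(1), of x] I(3) by (metis order_trans)
  then obtain g where g: "g \<in> I" "x * g = x" using x by (metis imageE)
  define N where "N = {w \<in> I. x * w = 0}"
  have "right_ideal N"
    unfolding right_ideal_def
  proof (intro conjI ballI allI)
    show "subspace N"
      using subI unfolding N_def
      by (auto simp: subspace_def distrib_left scale_mult_right[symmetric])
    show "\<And>w y. w \<in> N \<Longrightarrow> w * y \<in> N"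
      using mulI by (simp add: N_def mult.assoc[symmetric])
  qed
  moreover have "N \<subseteq> I" "N \<noteq> I" using y u by (auto simp: N_def x_def)
  ultimately have "N = {0}" using minI[of N] I(3) by blast
  moreover have "g * g - g \<in> N"
    using g mulI[OF g(1)] subspace_diff[OF subI] unfolding N_def
    by (simp add: right_diff_distrib mult.assoc[symmetric])
  ultimately have "g * g = g" by simp
  moreover have "g \<noteq> 0" using g(2) y u(1) by (auto simp: x_def)
  ultimately show thesis using that g I(3) by blast
qed

text \<open>Serves as a partial inverse of \<open>x\<close>: where idempotents are scarce,
  \<open>x * c\<close> is forced to be a unit element.\<close>

lemma right_mult_idempotent:
  fixes x :: 'a
  assumes "x \<noteq> 0"
  obtains c where "x * c \<noteq> 0" "(x * c) * (x * c) = x * c"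
proof -
  have "right_ideal UNIV" by (simp add: right_ideal_def)
  then have "right_ideal (range ((*) x))" by (rule right_ideal_mult_image)
  moreover have "range ((*) x) \<noteq> {0}" using assms by (metis mult.right_neutral rangeI singletonD)
  ultimately obtain g where g: "g \<in> range ((*) x)" "g \<noteq> 0" "g * g = g"
    using right_ideal_idempotent by blast
  then obtain c where "g = x * c" by blast
  then show thesis using that g(2,3) by simp
qed

text \<open>An idempotent f of the ideal with largest fA is a left unit, since otherwise an
  orthogonal idempotent could be added to it. Semiprimeness makes it a right unit, and a two-sided
  unit of an ideal is central.\<close>

lemma ideal_unit:
  assumes "ideal I"
  obtains \<epsilon> where "\<epsilon> \<in> I" "\<epsilon> \<in> center" "\<And>x. x \<in> I \<Longrightarrow> \<epsilon> * x = x"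
proof -
  have subI: "subspace I" and mulI: "\<And>x y. x \<in> I \<Longrightarrow> x * y \<in> I" "\<And>x y. x \<in> I \<Longrightarrow> y * x \<in> I"
    using assms by (auto simp: ideal_def)
  let ?P = "\<lambda>V. \<exists>f\<in>I. f * f = f \<and> V = range ((*) f)"
  have "?P (range ((*) 0))" using subspace_0[OF subI] by force
  then obtain V where V: "?P V" and maxV: "\<And>W. ?P W \<Longrightarrow> V \<subseteq> W \<Longrightarrow> W = V"
    using maximal_subspace[of ?P] range_mult_subspace by blast
  obtain f where f: "f \<in> I" "f * f = f" "V = range ((*) f)" using V by blast
  have fx: "f * x = x" if x: "x \<in> I" for x
  proof (rule ccontr)
    assume ne: "f * x \<noteq> x"
    define y where "y = x - f * x"
    have y: "y \<in> I" "f * y = 0" "y \<noteq> 0"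
      using x f ne mulI subspace_diff[OF subI]
      by (simp_all add: y_def right_diff_distrib mult.assoc[symmetric])
    obtain c where c: "y * c \<noteq> 0" "(y * c) * (y * c) = y * c"
      using right_mult_idempotent[OF y(3)] .
    define g where "g = y * c"
    have g: "g \<in> I" "f * g = 0" "g \<noteq> 0" "g * g = g"
      using y c mulI by (simp_all add: g_def mult.assoc[symmetric])
    \<comment> \<open>Only \<open>f * g = 0\<close> is known; removing \<open>g * f\<close> makes
      the new idempotent orthogonal to \<open>f\<close> on both sides.\<close>
    define h where "h = g - g * f"
    have hg: "h * g = g" using g by (simp add: h_def left_diff_distrib mult.assoc)
    have hf: "h * f = 0" using f by (simp add: h_def left_diff_distrib mult.assoc)
    have h: "h \<in> I" "f * h = 0" "h * h = h" "h \<noteq> 0"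
    proof -
      show "h \<in> I" using g f mulI subspace_diff[OF subI] by (simp add: h_def)
      show "f * h = 0" using g by (simp add: h_def right_diff_distrib mult.assoc[symmetric])
      have "h * h = h * g - h * (g * f)" by (simp add: h_def right_diff_distrib)
      also have "\<dots> = h" using hg by (simp add: mult.assoc[symmetric]) (simp add: h_def)
      finally show "h * h = h" .
      show "h \<noteq> 0" using hg g by auto
    qed
    have fh: "(f + h) * f = f" "(f + h) * h = h"
      using f h hf by (simp_all add: distrib_right)
    have "f + h \<in> I" using f h subspace_add[OF subI] by blast
    moreover have "(f + h) * (f + h) = f + h" using fh by (simp add: distrib_left)
    moreover have "V \<subseteq> range ((*) (f + h))"
      unfolding f(3) using fh(1) by (metis image_subsetI mult.assoc rangeI)
    ultimately have "range ((*) (f + h)) = V" using maxV by blast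
    then have "h \<in> range ((*) f)" using fh(2) f(3) by (metis rangeI)
    then have "f * h = h" using f(2) by (metis imageE mult.assoc)
    then show False using h by simp
  qed
  have xf: "x * f = x" if x: "x \<in> I" for x
  proof -
    \<comment> \<open>\<open>w * f = 0\<close>, while \<open>f\<close> fixes \<open>y * w\<close>
      from the left; inserting \<open>f\<close> gives \<open>w * y * w = 0\<close>.\<close>
    define w where "w = x - x * f"
    have "w * y * w = 0" for y
    proof -
      have "f * (y * w) = y * w"
        using fx x mulI subspace_diff[OF subI] by (simp add: w_def)
      moreover have "w * f = 0" using f by (simp add: w_def left_diff_distrib mult.assoc)
      ultimately show ?thesis by (metis mult.assoc mult_zero_left)
    qed
    then have "w = 0" by (rule semiprime)
    then show ?thesis by (simp add: w_def)
  qed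
  have "f \<in> center"
    by (rule centerI) (metis fx xf f(1) mulI mult.assoc)
  then show thesis using that f(1) fx by blast
qed

text \<open>Turns any nonzero \<open>v\<close> into a nonzero central value by a single map in M(A),
  namely into the unit of the ideal that \<open>v\<close> generates.\<close>

lemma generated_unit:
  fixes v :: 'a
  assumes "v \<noteq> 0"
  obtains m where "mult_map m" "m v \<in> center" "m v * v = v" "m v \<noteq> 0" "m v * m v = m v"
proof -
  obtain \<epsilon> where \<epsilon>: "\<epsilon> \<in> {m v | m. mult_map m}" "\<epsilon> \<in> center"
    "\<And>x. x \<in> {m v | m. mult_map m} \<Longrightarrow> \<epsilon> * x = x"
    using ideal_unit[OF generated_ideal[of v]] by blast
  then obtain m where m: "mult_map m" "\<epsilon> = m v" by blast
  have "\<epsilon> * v = v" using \<epsilon>(3) mult_map_id by blast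
  moreover have "\<epsilon> * \<epsilon> = \<epsilon>" using \<epsilon> by blast
  moreover have "\<epsilon> \<noteq> 0" using calculation(1) assms by auto
  ultimately show thesis using that[OF m(1)] \<epsilon>(2) unfolding m(2) by blast
qed

text \<open>Among the nonzero maps in $M(A)$ supported on a central summand, one with the largest
  kernel can be moved to have a central value; composing it with an inner derivation then
  enlarges the kernel, so all its values are central.\<close>

lemma separating_functional:
  fixes v :: 'a
  assumes "v \<noteq> 0"
  obtains c where "mult_map c" "\<And>x. c x \<in> center" "c v \<noteq> 0"
proof -
  obtain m0 where m0: "mult_map m0" "m0 v \<in> center" "m0 v * v = v" "m0 v \<noteq> 0" "m0 v * m0 v = m0 v"
    using generated_unit[OF assms] .
  define \<epsilon> where "\<epsilon> = m0 v"
  let ?Q = "\<lambda>M :: 'a \<Rightarrow> 'a. mult_map M \<and> (\<forall>x. M x = M (\<epsilon> * x)) \<and> (\<exists>x. M x \<noteq> 0)"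
  let ?P = "\<lambda>V. \<exists>M. ?Q M \<and> V = {x. M x = 0}"
  have PI: "?P {x. M x = 0}" if "?Q M" for M by (rule exI[of _ M]) (rule conjI[OF that refl])
  have Psub: "subspace V" if "?P V" for V using that ker_subspace by auto
  have "?Q (\<lambda>x. \<epsilon> * x)"
    using m0 mult_map_left by (auto simp: \<epsilon>_def mult.assoc[symmetric] intro: exI[of _ 1])
  then have P0: "?P {x. \<epsilon> * x = 0}" by (rule PI)
  then obtain V where V: "?P V" and maxV: "\<And>W. ?P W \<Longrightarrow> V \<subseteq> W \<Longrightarrow> W = V"
    using maximal_subspace[where P = ?P, OF P0 Psub] by blast
  obtain M where M: "mult_map M" "\<And>x. M x = M (\<epsilon> * x)" "V = {x. M x = 0}" and "\<exists>x. M x \<noteq> 0"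
    using V by blast
  then obtain x1 where x1: "M x1 \<noteq> 0" by blast
  obtain m1 where m1: "mult_map m1" "m1 (M x1) \<in> center" "m1 (M x1) \<noteq> 0"
    using generated_unit[OF x1] by metis
  define M2 where "M2 = (\<lambda>x. m1 (M x))"
  have M2: "mult_map M2" "\<And>x. M2 x = M2 (\<epsilon> * x)"
    using mult_map_comp[OF m1(1) M(1)] M(2) by (auto simp: M2_def)
  have sub: "V \<subseteq> {x. M2 x = 0}"
    using M(3) mult_map_zero_arg[OF m1(1)] by (auto simp: M2_def)
  have cen: "M2 x \<in> center" for x
  proof (rule ccontr)
    assume "M2 x \<notin> center"
    then obtain t where t: "M2 x * t \<noteq> t * M2 x" by (auto simp: center_def)
    define M3 where "M3 = (\<lambda>y. M2 y * t - t * M2 y)"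
    have M3: "mult_map M3"
      unfolding M3_def using mult_map_comp[OF mult_map_left M2(1)] mult_map_comp[OF mult_map_right M2(1)]
      by (intro mult_map_diff) auto
    have "M3 x \<noteq> 0" using t by (simp add: M3_def)
    moreover have "\<forall>x. M3 x = M3 (\<epsilon> * x)" unfolding M3_def using M2(2) by metis
    ultimately have "?P {x. M3 x = 0}" using M3 by (intro PI) blast
    moreover have "V \<subseteq> {x. M3 x = 0}" using sub by (auto simp: M3_def)
    ultimately have "{x. M3 x = 0} = V" using maxV by blast
    moreover have "M3 x1 = 0" using m1(2) by (simp add: M3_def M2_def centerD)
    ultimately show False using x1 M(3) by blast
  qed
  \<comment> \<open>At \<open>v\<close> the factor \<open>m0 y\<close> is \<epsilon>, so the value
    is \<open>M2 (\<epsilon> * x1) = M2 x1\<close>, the nonzero central value found above.\<close>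
  define c where "c = (\<lambda>y. M2 (m0 y * x1))"
  have "mult_map c"
    unfolding c_def using mult_map_comp[OF M2(1) mult_map_comp[OF mult_map_right m0(1)]] .
  moreover have "c v \<noteq> 0"
    unfolding c_def \<epsilon>_def[symmetric] M2(2)[symmetric] using m1(3) by (simp add: M2_def)
  ultimately show thesis using that cen by (auto simp: c_def)
qed

text \<open>Von Neumann regularity of the center, the substitute for dividing by a nonzero central
  element.\<close>

lemma center_regular:
  fixes z :: 'a
  assumes "z \<in> center"
  obtains z' where "z' \<in> center" "z * z' * z = z"
proof (cases "z = 0")
  case True
  then show thesis using that[of 1] center_one by simp
next
  case False
  obtain m where m: "mult_map m" "m z \<in> center" "m z * z = z" "m z * m z = m z"
    using generated_unit[OF False] by metis
  define x where "x = m 1"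
  have zx: "m z = z * x" using mult_map_center[OF m(1) assms, of 1] by (simp add: x_def)
  \<comment> \<open>\<open>x\<close> itself need not be central, but \<open>z\<close> annihilates
    its commutators because \<open>z * x\<close> is central.\<close>
  have "z * x * x \<in> center"
  proof (rule centerI)
    fix y
    have "z * (x * y - y * x) = 0"
      using m(2) zx assms by (simp add: right_diff_distrib mult.assoc[symmetric]) (metis centerD mult.assoc)
    then have "x * z * (x * y - y * x) = 0" by (simp add: mult.assoc)
    then have "z * x * (x * y) = z * x * (y * x)"
      using centerD[OF assms] by (simp add: right_diff_distrib)
    then show "z * x * x * y = y * (z * x * x)"
      using centerD[OF m(2)] zx by (metis mult.assoc)
  qed
  moreover have "z * (z * x * x) * z = z"
    using m(3,4) zx centerD[OF assms] by (metis mult.assoc)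
  ultimately show thesis using that by blast
qed

text \<open>This is the dual basis criterion for A to be finitely generated projective over Z, with
  coordinates in M(A). Among the maps \<open>f\<close> given by finite expansions, one with the
  largest space of fixed points must be the identity.\<close>

lemma central_dual_basis:
  "\<exists>(n::nat) c v. (\<forall>i. mult_map (c i)) \<and> (\<forall>i x. c i x \<in> center) \<and>
    (\<forall>x::'a. x = (\<Sum>i<n. c i x * v i))"
proof -
  define R where "R f \<longleftrightarrow> (\<exists>(n::nat) c v. (\<forall>i. mult_map (c i)) \<and> (\<forall>i x. c i x \<in> center) \<and>
     (\<forall>x. f x = (\<Sum>i<n. c i x * v i)))" for f :: "'a \<Rightarrow> 'a"
  have R_map: "mult_map f" if R: "R f" for f
  proof -
    obtain n c v where c: "\<forall>i. mult_map (c i)" "\<forall>x::'a. f x = (\<Sum>i<(n::nat). c i x * v i)"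
      using R R_def by blast
    have "mult_map (\<lambda>x. \<Sum>i<n. c i x * v i)"
      using c(1) mult_map_comp[OF mult_map_right] by (intro mult_map_sum) auto
    moreover have "f = (\<lambda>x. \<Sum>i<n. c i x * v i)" using c(2) by blast
    ultimately show ?thesis by simp
  qed
  define P where "P V \<longleftrightarrow> (\<exists>f. R f \<and> V = {x. x - f x = 0})" for V
  have "R (\<lambda>x. 0)"
    unfolding R_def
    by (rule exI[of _ 0], rule exI[of _ "\<lambda>i x. 0"]) (simp add: mult_map_zero center_def)
  then have P0: "P {x. x - (\<lambda>x. 0) x = 0}" unfolding P_def by (intro exI[of _ "\<lambda>x. 0"] conjI refl)
  have Psub: "subspace V" if PV: "P V" for V
  proof -
    obtain f where "R f" "V = {x. x - f x = 0}" using PV P_def by blast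
    then show ?thesis using ker_subspace[OF mult_map_diff[OF mult_map_id R_map]] by metis
  qed
  obtain V where V: "P V" and maxV: "\<And>W. P W \<Longrightarrow> V \<subseteq> W \<Longrightarrow> W = V"
    using maximal_subspace[where P = P, OF P0 Psub] by blast
  obtain f where f: "R f" and Vf: "V = {x. x - f x = 0}"
    using V P_def by blast
  define g where "g = (\<lambda>x. x - f x)"
  have g: "mult_map g" unfolding g_def using R_map[OF f] mult_map_diff[OF mult_map_id] by blast
  have "g v = 0" for v
  proof (rule ccontr)
    assume "g v \<noteq> 0"
    then obtain l where l: "mult_map l" "\<And>x. l x \<in> center" "l (g v) \<noteq> 0"
      using separating_functional by blast
    define z where "z = l (g v)"
    obtain z' where z': "z' \<in> center" "z * z' * z = z"
      using center_regular[of z] l(2) z_def by blast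
    have zz: "z * z' \<in> center" using center_mult z'(1) l(2) z_def by blast
    \<comment> \<open>The correction vanishes on the fixed points of \<open>f\<close>; since
      \<open>z * z' * z = z\<close>, it makes \<open>z * z' * v\<close> an additional fixed
      point.\<close>
    define f' where "f' = (\<lambda>x. f x + l (g x) * (z' * g v))"
    obtain n c u where c: "\<forall>i. mult_map (c i)" "\<forall>i x. c i x \<in> center"
      "\<forall>x::'a. f x = (\<Sum>i<(n::nat). c i x * u i)"
      using f R_def by blast
    have "R f'"
      unfolding R_def
    proof (intro exI conjI allI)
      let ?c = "c(n := \<lambda>x. l (g x))" and ?u = "u(n := z' * g v)"
      show "mult_map (?c i)" for i using c(1) mult_map_comp[OF l(1) g] by simp
      show "?c i x \<in> center" for i x using c(2) l(2) by simp
      show "f' x = (\<Sum>i<Suc n. ?c i x * ?u i)" for x by (simp add: f'_def c(3))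
    qed
    then have "P {x. x - f' x = 0}" unfolding P_def by (intro exI[of _ f'] conjI refl)
    moreover have "V \<subseteq> {x. x - f' x = 0}"
      using mult_map_zero_arg[OF l(1)] by (auto simp: Vf f'_def g_def)
    ultimately have eq: "{x. x - f' x = 0} = V" using maxV by blast
    define w where "w = z * z' * v"
    have gw: "g w = z * z' * g v" unfolding w_def using mult_map_center[OF g zz] .
    then have lw: "l (g w) = z" using mult_map_center[OF l(1) zz] z'(2) z_def by simp
    have "w - f' w = g w - l (g w) * (z' * g v)" by (simp add: f'_def g_def)
    also have "\<dots> = 0" by (simp only: lw) (simp add: gw mult.assoc)
    finally have "w \<in> V" using eq by blast
    then have "g w = 0" by (simp add: Vf g_def)
    then have "z = 0" using lw mult_map_zero_arg[OF l(1)] by simp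
    then show False using l(3) z_def by simp
  qed
  then have fx: "f x = x" for x by (simp add: g_def)
  obtain n c u where c: "\<forall>i. mult_map (c i)" "\<forall>i x. c i x \<in> center"
      "\<forall>x::'a. f x = (\<Sum>i<(n::nat). c i x * u i)"
      using f R_def by blast
  have "x = (\<Sum>i<n. c i x * u i)" for x using c(3) fx by simp
  then show ?thesis using c(1,2) by blast
qed

lemma center_linear_mult_map:
  fixes J :: "'a \<Rightarrow> 'a"
  assumes "\<And>x y. J (x + y) = J x + J y" "\<And>z x. z \<in> center \<Longrightarrow> J (z * x) = z * J x"
  shows "mult_map J"
proof -
  obtain n :: nat and c v where "\<forall>i. mult_map (c i)" "\<forall>i x. c i x \<in> center"
    and c': "\<forall>x::'a. x = (\<Sum>i<n. c i x * v i)"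
    using central_dual_basis by blast
  then have c: "\<And>i. mult_map (c i)" "\<And>i x. c i x \<in> center"
    by blast+
  note c = c c'[rule_format]
  have J0: "J 0 = 0" using assms(1)[of 0 0] by simp
  have "J (\<Sum>i\<in>I. g i) = (\<Sum>i\<in>I. J (g i))" for g :: "nat \<Rightarrow> 'a" and I
    by (induction I rule: infinite_finite_induct) (simp_all add: assms J0)
  then have "J (\<Sum>i<n. c i x * v i) = (\<Sum>i<n. c i x * J (v i))" for x
    by (simp add: assms(2)[OF c(2)])
  then have "J = (\<lambda>x. \<Sum>i<n. c i x * J (v i))"
    unfolding c(3)[symmetric] by blast
  moreover have "mult_map (\<lambda>x. \<Sum>i<n. c i x * J (v i))"
    using c(1) mult_map_comp[OF mult_map_right] by (intro mult_map_sum) auto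
  ultimately show ?thesis by simp
qed

section \<open>Nondegeneracy modulo commutators\<close>

abbreviation K :: "'a set" where "K \<equiv> commutator_span scale"

lemma K_subspace: "subspace K"
  by (simp add: commutator_span_def)

lemma K_commutator: "x * y - y * x \<in> K"
  unfolding commutator_span_def by (rule span_base) blast

lemma K_center:
  assumes "z \<in> center" "x \<in> K"
  shows "z * x \<in> K"
  using assms(2) unfolding commutator_span_def
proof (induction rule: span_induct_alt)
  case (step c u y)
  from step.hyps obtain a b where u: "u = a * b - b * a" by blast
  have "b * (z * a) = z * (b * a)"
    by (simp only: mult.assoc[symmetric] centerD[OF assms(1), of b])
  then have "z * u = (z * a) * b - b * (z * a)"
    by (simp only: u right_diff_distrib mult.assoc)
  then have "z * u \<in> span {x * y - y * x | x y. True}"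
    using K_commutator[of "z * a" b] by (simp only: commutator_span_def)
  then show ?case
    using step.IH by (simp only: distrib_left scale_mult_right[symmetric] span_add span_scale)
qed (simp add: span_zero)

text \<open>If $xA \subseteq [A,A]$, every operator $y \mapsto a x y b$ has trace zero over the center.
  Some coordinate functional does not vanish at $x$, and $y \mapsto c_i(xy)$ is a sum of such
  operators whose trace is $c_i(x)$.\<close>

lemma nondegenerate:
  fixes x :: 'a
  assumes x: "\<And>y. x * y \<in> K"
  shows "x = 0"
proof (rule ccontr)
  assume "x \<noteq> 0"
  obtain n :: nat and c v where "\<forall>i. mult_map (c i)" "\<forall>i x. c i x \<in> center"
    and c': "\<forall>x::'a. x = (\<Sum>i<n. c i x * v i)"
    using central_dual_basis by blast
  then have c: "\<And>i. mult_map (c i)" "\<And>i x. c i x \<in> center"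
    by blast+
  note c = c c'[rule_format]
  \<comment> \<open>The \<open>v k\<close> need not be independent over Z, so this is the
    Hattori-Stallings trace; the property required of it is cyclicity.\<close>
  define Tr where "Tr M = (\<Sum>k<n. c k (M (v k)))" for M :: "'a \<Rightarrow> 'a"
  have Tr_comm: "Tr (\<lambda>x. M (N x)) = Tr (\<lambda>x. N (M x))" if M: "mult_map M" and N: "mult_map N" for M N
  proof -
    have expand: "Tr (\<lambda>x. M (N x)) = (\<Sum>k<n. \<Sum>l<n. c l (N (v k)) * c k (M (v l)))"
      if M: "mult_map M" for M N
    proof -
      have "M (N (v k)) = (\<Sum>l<n. c l (N (v k)) * M (v l))" for k
      proof -
        have "M (N (v k)) = M (\<Sum>l<n. c l (N (v k)) * v l)" by (rule arg_cong[OF c(3)])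
        then show ?thesis by (simp add: mult_map_sum_arg[OF M] mult_map_center[OF M c(2)])
      qed
      then show ?thesis
        unfolding Tr_def by (simp add: mult_map_sum_arg[OF c(1)] mult_map_center[OF c(1) c(2)])
    qed
    have "(\<Sum>k<n. \<Sum>l<n. c l (N (v k)) * c k (M (v l))) = (\<Sum>l<n. \<Sum>k<n. c k (M (v l)) * c l (N (v k)))"
      by (subst sum.swap) (intro sum.cong refl centerD c(2))
    then show ?thesis using expand[OF M] expand[OF N] by simp
  qed
  have Tr_add: "Tr (\<lambda>x. M x + N x) = Tr M + Tr N" for M N
    by (simp add: Tr_def mult_map_plus[OF c(1)] sum.distrib)
  have Tr_K: "Tr (\<lambda>y. u * y * b) = 0" if "u \<in> K" for u b
    using that unfolding commutator_span_def
  proof (induction rule: span_induct_alt)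
    case base
    show ?case by (simp add: Tr_def mult_map_zero_arg[OF c(1)])
  next
    case (step s u w)
    then obtain p q where u: "u = p * q - q * p" by blast
    have "Tr (\<lambda>y. p * (q * y * b)) = Tr (\<lambda>y. q * (p * y) * b)"
      using Tr_comm[OF mult_map_left[of p] mult_map_base[of q b]] .
    moreover have "Tr (\<lambda>y. p * (q * y * b)) = Tr (\<lambda>y. u * y * b + q * (p * y) * b)"
      by (rule arg_cong[of _ _ Tr]) (auto simp: u algebra_simps)
    ultimately have u0: "Tr (\<lambda>y. u * y * b) = 0" by (simp add: Tr_add)
    have "Tr (\<lambda>y. scale s u * y * b) = scale s (Tr (\<lambda>y. u * y * b))"
      by (simp add: Tr_def scale_mult_left[symmetric] mult_map_scale[OF c(1)] scale_sum_right)
    then show ?case using u0 step.IH by (simp add: distrib_right Tr_add)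
  qed
  have "\<exists>i<n. c i x \<noteq> 0"
  proof (rule ccontr)
    assume "\<not> ?thesis"
    then have "(\<Sum>i<n. c i x * v i) = 0" by simp
    then show False using \<open>x \<noteq> 0\<close> unfolding c(3)[symmetric] by blast
  qed
  then obtain i where i: "c i x \<noteq> 0" by blast
  have zero: "Tr (\<lambda>y. f (x * y)) = 0" if "mult_map f" for f
    using that
  proof induction
    case (mult_map_base a b)
    have "a * x \<in> K"
      using subspace_diff[OF K_subspace x[of a] K_commutator[of x a]] by simp
    then show ?case using Tr_K[of "a * x" b] by (simp add: mult.assoc)
  qed (simp add: Tr_add)
  \<comment> \<open>Central values pass through \<open>c k\<close> and leave the factor
    \<open>c k 1\<close>; the sum then reassembles 1 from its coordinates.\<close>
  have "Tr (\<lambda>y. c i (x * y)) = (\<Sum>k<n. c i (x * v k) * c k 1)"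
    unfolding Tr_def using mult_map_center[OF c(1) c(2), of _ _ _ 1] by simp
  also have "\<dots> = (\<Sum>k<n. c i (x * (c k 1 * v k)))"
  proof (rule sum.cong)
    fix k
    have "x * (c k 1 * v k) = c k 1 * (x * v k)" using centerD[OF c(2)[of k 1]] by (metis mult.assoc)
    then show "c i (x * v k) * c k 1 = c i (x * (c k 1 * v k))"
      by (simp only: mult_map_center[OF c(1) c(2)]) (rule centerD[OF c(2), symmetric])
  qed simp
  also have "\<dots> = c i (x * (\<Sum>k<n. c k 1 * v k))"
    by (simp add: sum_distrib_left mult_map_sum_arg[OF c(1)])
  also have "\<dots> = c i x" unfolding c(3)[of 1, symmetric] by simp
  finally show False using zero[OF c(1)] i by simp
qed

section \<open>Jordan automorphisms modulo commutators\<close>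

text \<open>For idempotent \<open>f\<close> this is the Peirce corner fAf; the fixed-point form
  needs no witness.\<close>

definition corner :: "'a \<Rightarrow> 'a set" where
  "corner f = {x. f * x = x \<and> x * f = x}"

lemma corner_mult: "x \<in> corner f \<Longrightarrow> y \<in> corner f \<Longrightarrow> x * y \<in> corner f"
  by (simp add: corner_def mult.assoc) (simp add: mult.assoc[symmetric])

text \<open>The extra factor \<open>x\<close> is there because \<open>y ^ 0 = 1\<close> lies outside
  a proper corner.\<close>

lemma corner_mult_power: "x \<in> corner f \<Longrightarrow> y \<in> corner f \<Longrightarrow> x * y ^ n \<in> corner f"
  by (induction n) (simp_all add: power_Suc2 mult.assoc[symmetric] corner_mult del: power_Suc)

lemma corner_diff: "x \<in> corner f \<Longrightarrow> y \<in> corner f \<Longrightarrow> x - y \<in> corner f"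
  by (simp add: corner_def algebra_simps)

lemma corner_zero: "0 \<in> corner f"
  by (simp add: corner_def)

lemma corner_add: "x \<in> corner f \<Longrightarrow> y \<in> corner f \<Longrightarrow> x + y \<in> corner f"
  by (simp add: corner_def algebra_simps)

lemma corner_sum: "(\<And>i. i \<in> I \<Longrightarrow> g i \<in> corner f) \<Longrightarrow> (\<Sum>i\<in>I. g i) \<in> corner f"
  by (induction I rule: infinite_finite_induct) (simp_all add: corner_zero corner_add)

lemma corner_scale: "x \<in> corner f \<Longrightarrow> scale c x \<in> corner f"
  by (simp add: corner_def scale_mult_left[symmetric] scale_mult_right[symmetric])

lemma cornerI: "f * f = f \<Longrightarrow> f * x * f \<in> corner f"
  by (simp add: corner_def mult.assoc) (simp add: mult.assoc[symmetric])

text \<open>A primitive corner is a division ring. The idempotent \<open>x * c\<close> may lie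
  outside the corner, but multiplied by \<open>f\<close> on the right it is a nonzero idempotent
  inside it, hence equal to \<open>f\<close>.\<close>

lemma corner_inverse:
  assumes f: "f * f = f" and prim: "\<And>g. g \<in> corner f \<Longrightarrow> g * g = g \<Longrightarrow> g = 0 \<or> g = f"
    and x: "x \<in> corner f" "x \<noteq> 0"
  obtains y where "y \<in> corner f" "x * y = f" "y * x = f"
proof -
  have right: "\<exists>y\<in>corner f. x * y = f" if x: "x \<in> corner f" "x \<noteq> 0" for x
  proof -
    obtain c where c: "x * c \<noteq> 0" "(x * c) * (x * c) = x * c"
      using right_mult_idempotent[OF x(2)] .
    define h where "h = x * c"
    have h: "f * h = h" "h * h = h" "h \<noteq> 0"
      using c x by (simp_all add: h_def corner_def mult.assoc[symmetric])
    have "h * f * h = h" using h by (simp add: mult.assoc)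
    then have "h * f \<noteq> 0" using h by auto
    moreover have "h * f \<in> corner f" using h f by (simp add: corner_def mult.assoc) (simp add: mult.assoc[symmetric])
    moreover have "(h * f) * (h * f) = h * f" using \<open>h * f * h = h\<close> by (simp add: mult.assoc[symmetric])
    ultimately have "h * f = f" using prim by blast
    moreover have "x * (f * c * f) = h * f" using x by (simp add: h_def corner_def mult.assoc[symmetric])
    ultimately show ?thesis using cornerI[OF f] by metis
  qed
  obtain y where y: "y \<in> corner f" "x * y = f" using right x by blast
  have "f \<noteq> 0" using x by (auto simp: corner_def)
  then have "y \<noteq> 0" using y by auto
  then obtain w where w: "w \<in> corner f" "y * w = f" using right y by blast
  have "w = x * y * w" using w(1) y(2) by (simp add: corner_def)
  also have "\<dots> = x" using w(2) x(1) by (simp add: mult.assoc corner_def)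
  finally have "w = x" .
  then show thesis using that[OF y] w(2) by simp
qed

text \<open>Provides a first monic relation, over the ground field; the minimal one over the center
  of a corner is found by descent from it.\<close>

lemma power_dependent:
  obtains m s where "x ^ m = (\<Sum>j<m. scale (s j) (x ^ j))"
proof -
  have "\<exists>m. x ^ m \<in> span ((\<lambda>j. x ^ j) ` {..<m})"
  proof (rule ccontr)
    assume "\<not> ?thesis"
    then have out: "x ^ m \<notin> span ((\<lambda>j. x ^ j) ` {..<m})" for m by blast
    have "independent ((\<lambda>j. x ^ j) ` {..<m}) \<and> card ((\<lambda>j. x ^ j) ` {..<m}) = m" for m
    proof (induction m)
      case (Suc m)
      have "x ^ m \<notin> (\<lambda>j. x ^ j) ` {..<m}" by (rule contra_subsetD[OF span_superset out])
      then show ?case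
        using Suc out[of m] by (simp add: lessThan_Suc independent_insert)
    qed (simp add: independent_empty)
    then have "independent ((\<lambda>j. x ^ j) ` {..<Suc (card Basis)})"
      "card ((\<lambda>j. x ^ j) ` {..<Suc (card Basis)}) = Suc (card Basis)" by blast+
    then show False using independent_card_le_dim[OF subset_UNIV] dim_UNIV
      by (metis Suc_n_not_le_n)
  qed
  then obtain m where m: "x ^ m \<in> span ((\<lambda>j. x ^ j) ` {..<m})" ..
  have "\<exists>s. v = (\<Sum>j<n. scale (s j) (x ^ j))" if "v \<in> span ((\<lambda>j. x ^ j) ` {..<n})" for v n
    using that
  proof (induction n arbitrary: v)
    case (Suc n)
    then obtain k where "v - scale k (x ^ n) \<in> span ((\<lambda>j. x ^ j) ` {..<n})"
      unfolding lessThan_Suc image_insert span_breakdown_eq by blast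
    then obtain s where "v - scale k (x ^ n) = (\<Sum>j<n. scale (s j) (x ^ j))" using Suc.IH by blast
    then have "v = (\<Sum>j<Suc n. scale ((s(n := k)) j) (x ^ j))" by (simp add: algebra_simps)
    then show ?case by (rule exI[of _ "s(n := k)"])
  qed simp
  then obtain s where "x ^ m = (\<Sum>j<m. scale (s j) (x ^ j))" using m by metis
  then show thesis by (rule that)
qed

text \<open>A shortest relation $\sum_{j\le m} c_j\, d\, x^j = 0$ valid for all $d$ in the division
  ring $fAf$ has central coefficients, so it is the minimal polynomial of $x$ over the center.
  By hypothesis it also annihilates $y$. Dividing it by $t - y$ yields a shorter expression
  $u = \sum_{j<m} b_j\, d\, x^j$ with $yu = ux$, nonzero for some $d$ by minimality.\<close>

lemma division_intertwiner:
  assumes f: "f * f = f" "f \<noteq> 0"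
    and inv: "\<And>x. x \<in> corner f \<Longrightarrow> x \<noteq> 0 \<Longrightarrow> \<exists>y\<in>corner f. y * x = f"
    and xy: "x \<in> corner f" "y \<in> corner f"
    and root: "\<And>m c. (\<And>k. k \<le> m \<Longrightarrow> c k \<in> corner f) \<Longrightarrow>
      (\<And>k d. k \<le> m \<Longrightarrow> d \<in> corner f \<Longrightarrow> c k * d = d * c k) \<Longrightarrow>
      (\<Sum>k\<le>m. c k * x ^ k) = 0 \<Longrightarrow> (\<Sum>k\<le>m. c k * y ^ k) = 0"
  obtains u where "u \<in> corner f" "u \<noteq> 0" "y * u = u * x"
proof -
  define Q where "Q m \<longleftrightarrow> (\<exists>c. (\<forall>j\<le>m. c j \<in> corner f) \<and> c m = f \<and>
    (\<forall>d\<in>corner f. (\<Sum>j\<le>m. c j * d * x ^ j) = 0))" for m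
  have fc: "f \<in> corner f" using f by (simp add: corner_def)
  have "\<exists>m. Q m"
  proof -
    obtain m s where ms: "x ^ m = (\<Sum>j<m. scale (s j) (x ^ j))" by (rule power_dependent)
    define c where "c j = (if j = m then f else scale (- s j) f)" for j
    have "(\<Sum>j\<le>m. c j * d * x ^ j) = 0" if d: "d \<in> corner f" for d
    proof -
      have fd: "f * d = d" using d by (simp add: corner_def)
      have "(\<Sum>j\<le>m. c j * d * x ^ j) = (\<Sum>j<m. scale (- s j) f * d * x ^ j) + f * d * x ^ m"
        by (simp add: lessThan_Suc_atMost[symmetric] c_def)
      also have "(\<Sum>j<m. scale (- s j) f * d * x ^ j) = - (d * (\<Sum>j<m. scale (s j) (x ^ j)))"
        by (simp add: scale_mult_left[symmetric] scale_mult_right[symmetric] fd sum_distrib_left sum_negf)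
      finally show ?thesis using ms fd by simp
    qed
    moreover have "c j \<in> corner f" for j
      using corner_scale[OF fc, of "- s j"] fc by (simp add: c_def)
    ultimately have "Q m" unfolding Q_def by (intro exI[of _ c]) (simp add: c_def)
    then show ?thesis by blast
  qed
  then obtain m where m: "Q m" and least: "\<And>k. k < m \<Longrightarrow> \<not> Q k"
    by (metis LeastI not_less_Least)
  \<comment> \<open>A nontrivial relation of length below \<open>m\<close> would become monic on
    multiplying by an inverse of its top nonzero coefficient, against the choice of
    \<open>m\<close>.\<close>
  have indep: "b j = 0" if b: "\<And>j. j < m \<Longrightarrow> b j \<in> corner f"
    and b0: "\<And>d. d \<in> corner f \<Longrightarrow> (\<Sum>j<m. b j * d * x ^ j) = 0" and j: "j < m" for b j
  proof (rule ccontr)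
    assume "b j \<noteq> 0"
    then obtain k where k: "k < m" "b k \<noteq> 0" and top: "\<And>i. i < m \<Longrightarrow> b i \<noteq> 0 \<Longrightarrow> i \<le> k"
      using ex_has_greatest_nat[of "\<lambda>i. i < m \<and> b i \<noteq> 0" j id m] j by auto
    obtain w where w: "w \<in> corner f" "w * b k = f" using inv b k by blast
    have "(\<Sum>i\<le>k. (w * b i) * d * x ^ i) = 0" if d: "d \<in> corner f" for d
    proof -
      have "(\<Sum>i\<le>k. b i * d * x ^ i) = (\<Sum>i<m. b i * d * x ^ i)"
      proof (rule sum.mono_neutral_left)
        show "\<forall>i\<in>{..<m} - {..k}. b i * d * x ^ i = 0"
          using top by (metis DiffE atMost_iff lessThan_iff mult_zero_left)
      qed (use k in auto)
      then have "w * (\<Sum>i\<le>k. b i * d * x ^ i) = 0" using b0[OF d] by simp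
      then show ?thesis by (simp add: sum_distrib_left mult.assoc)
    qed
    moreover have "\<forall>i\<le>k. w * b i \<in> corner f" using b k(1) w(1) by (simp add: corner_mult)
    ultimately have "Q k" unfolding Q_def using w(2) by (intro exI[of _ "\<lambda>i. w * b i"]) simp
    then show False using least k(1) by blast
  qed
  obtain c where c: "\<And>j. j \<le> m \<Longrightarrow> c j \<in> corner f" "c m = f"
    and rel: "\<And>d. d \<in> corner f \<Longrightarrow> (\<Sum>j\<le>m. c j * d * x ^ j) = 0"
    using m unfolding Q_def by blast
  have central: "c k * t = t * c k" if k: "k \<le> m" and t: "t \<in> corner f" for k t
  proof (cases "k = m")
    case True
    then show ?thesis using t c(2) by (simp add: corner_def)
  next
    case False
    \<comment> \<open>Subtracting \<open>t\<close> times the relation at \<open>d\<close> from the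
      relation at \<open>t * d\<close> cancels the top coefficient \<open>f\<close>, so
      \<open>indep\<close> applies to these commutators.\<close>
    define b where "b j = c j * t - t * c j" for j
    have "b k = 0"
    proof (rule indep)
      show "b j \<in> corner f" if "j < m" for j
        using that c(1) t by (simp add: b_def corner_diff corner_mult)
      show "k < m" using k False by simp
      fix d assume d: "d \<in> corner f"
      have bm: "b m = 0" using t c(2) by (simp add: b_def corner_def)
      have "(\<Sum>j<m. b j * d * x ^ j) = (\<Sum>j\<le>m. b j * d * x ^ j)"
        by (simp add: lessThan_Suc_atMost[symmetric] bm)
      also have "\<dots> = (\<Sum>j\<le>m. c j * (t * d) * x ^ j) - t * (\<Sum>j\<le>m. c j * d * x ^ j)"
        by (simp add: b_def sum_distrib_left sum_subtractf left_diff_distrib mult.assoc)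
      also have "\<dots> = 0" using rel d t by (simp add: corner_mult)
      finally show "(\<Sum>j<m. b j * d * x ^ j) = 0" .
    qed
    then show ?thesis by (simp add: b_def)
  qed
  have "c k * f * x ^ k = c k * x ^ k" if "k \<le> m" for k using c(1)[OF that] by (simp add: corner_def)
  then have "(\<Sum>k\<le>m. c k * x ^ k) = 0" using rel[OF fc] by simp
  then have cy: "(\<Sum>k\<le>m. c k * y ^ k) = 0" using root c(1) central by blast
  \<comment> \<open>Horner's scheme: the \<open>B (Suc j)\<close> are the coefficients of the
    quotient by t - y, and \<open>B 0\<close> is the remainder, that is, the value at
    \<open>y\<close>.\<close>
  define B where "B j = (\<Sum>i<Suc m - j. c (j + i) * y ^ i)" for j
  have B0: "B 0 = 0" using cy by (simp add: B_def lessThan_Suc_atMost)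
  have BSm: "B (Suc m) = 0" by (simp add: B_def)
  have Bm: "B m = f" by (simp add: B_def c(2))
  have B_step: "y * B (Suc j) = B j - c j" if j: "j \<le> m" for j
  proof -
    have "y * (c (Suc j + i) * y ^ i) = c (j + Suc i) * y ^ Suc i" if "i < m - j" for i
      using central[of "Suc j + i" y] that xy(2) by (simp add: mult.assoc[symmetric])
    then have "y * B (Suc j) = (\<Sum>i<m - j. c (j + Suc i) * y ^ Suc i)"
      unfolding B_def by (simp add: sum_distrib_left)
    also have "\<dots> = B j - c j"
      unfolding B_def Suc_diff_le[OF j] by (subst sum.lessThan_Suc_shift) simp
    finally show ?thesis .
  qed
  have Bc: "B j \<in> corner f" if "j \<le> m" for j
    unfolding B_def using c(1) xy(2) that by (intro corner_sum corner_mult_power) auto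
  have "m \<noteq> 0" using Bm B0 f(2) by metis
  define G where "G d = (\<Sum>j<m. B (Suc j) * d * x ^ j)" for d
  have "\<exists>d\<in>corner f. G d \<noteq> 0"
  proof (rule ccontr)
    assume "\<not> ?thesis"
    then have "B (Suc (m - 1)) = 0"
      using \<open>m \<noteq> 0\<close> by (intro indep[of "\<lambda>j. B (Suc j)"]) (auto simp: G_def Bc)
    then show False using \<open>m \<noteq> 0\<close> Bm f(2) by simp
  qed
  then obtain d where d: "d \<in> corner f" "G d \<noteq> 0" by blast
  \<comment> \<open>By \<open>B_step\<close> the factor \<open>y\<close> lowers the index of
    \<open>B\<close>, at the cost of the relation, which is zero; as \<open>B 0 = 0\<close>, the
    index shift leaves a factor \<open>x\<close> on the right.\<close>
  have "y * G d = (\<Sum>j<m. (y * B (Suc j)) * d * x ^ j)"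
    by (simp add: G_def sum_distrib_left mult.assoc)
  also have "\<dots> = (\<Sum>j\<le>m. (y * B (Suc j)) * d * x ^ j)"
    by (simp add: lessThan_Suc_atMost[symmetric] BSm)
  also have "\<dots> = (\<Sum>j\<le>m. B j * d * x ^ j) - (\<Sum>j\<le>m. c j * d * x ^ j)"
    by (simp add: B_step sum_subtractf left_diff_distrib)
  also have "\<dots> = (\<Sum>j<Suc m. B j * d * x ^ j)" using rel[OF d(1)] by (simp add: lessThan_Suc_atMost)
  also have "\<dots> = G d * x"
    by (subst sum.lessThan_Suc_shift)
      (simp add: B0 G_def sum_distrib_right mult.assoc power_Suc2 del: power_Suc)
  finally have "y * G d = G d * x" .
  moreover have "G d \<in> corner f"
    unfolding G_def using Bc d(1) xy(1) by (intro corner_sum corner_mult_power corner_mult) auto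
  ultimately show thesis using that d(2) by blast
qed

end

locale semiprime_algebra_23 = semiprime_algebra scale Basis
  for scale :: "'k::field \<Rightarrow> 'a::ring_1 \<Rightarrow> 'a" and Basis :: "'a set" +
  assumes two: "(2::'k) \<noteq> 0" and three: "(3::'k) \<noteq> 0"
begin

lemma scale_two: "scale 2 x = x + x"
  by (metis one_add_one scale_left_distrib scale_one)

lemma scale_three: "scale 3 x = x + x + x"
proof -
  have "scale 3 x = scale (2 + 1) x" by simp
  then show ?thesis by (simp only: scale_two scale_left_distrib scale_one)
qed

lemma double_eq: "x + x = y + y \<Longrightarrow> x = (y :: 'a)"
  using scale_cancel_left[of 2 x y] two by (simp add: scale_two)

lemma double_zero: "x + x = 0 \<Longrightarrow> x = (0 :: 'a)"
  using double_eq[of x 0] by simp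

lemma K_half:
  assumes "x + x \<in> K"
  shows "x \<in> K"
  using subspace_scale[OF K_subspace assms, of "1/2"] two by (simp add: scale_two[symmetric])

lemma K_third:
  assumes "x + x + x \<in> K"
  shows "x \<in> K"
  using subspace_scale[OF K_subspace assms, of "1/3"] three by (simp add: scale_three[symmetric])

lemmas K_add = subspace_add[OF K_subspace]
  and K_diff = subspace_diff[OF K_subspace]
  and K_zero = subspace_0[OF K_subspace]

section \<open>Jordan automorphisms and Peirce components\<close>

context
  fixes J
  assumes J: "jordan_automorphism scale J"
begin

lemma J_linear: "Vector_Spaces.linear scale scale J"
  using J by (simp add: jordan_automorphism_def)

interpretation J: Vector_Spaces.linear scale scale J
  by (rule J_linear)

lemma J_inj: "J x = J y \<longleftrightarrow> x = y"
  using J by (simp add: jordan_automorphism_def bij_def inj_eq)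

lemma J_surj: "\<exists>x. y = J x"
  using J by (metis jordan_automorphism_def bij_def surj_def)

lemma J_jordan: "J (x * y + y * x) = J x * J y + J y * J x"
  using J by (simp add: jordan_automorphism_def)

lemma J_square: "J (x * x) = J x * J x"
  using J_jordan[of x x, unfolded J.add] by (rule double_eq)

lemma J_one: "J 1 = 1"
proof -
  obtain w where w: "J w = 1" using J_surj by metis
  have "J 1 + J 1 = 1 + 1"
    using J_jordan[of 1 w] by (simp add: J.add w)
  then show ?thesis by (rule double_eq)
qed

text \<open>Twice the triple product is a Jordan expression: 2 x y x = x o (x o y) - x^2 o
  y.\<close>

lemma J_triple: "J (x * y * x) = J x * J y * J x"
proof (rule double_eq)
  have "x * y * x + x * y * x = (x * (x * y + y * x) + (x * y + y * x) * x) - ((x * x) * y + y * (x * x))"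
    by (simp add: algebra_simps)
  then have "J (x * y * x) + J (x * y * x) =
      J x * (J x * J y + J y * J x) + (J x * J y + J y * J x) * J x - ((J x * J x) * J y + J y * (J x * J x))"
    by (simp only: J.add[symmetric] J.diff J_jordan J_square)
  then show "J (x * y * x) + J (x * y * x) = J x * J y * J x + J x * J y * J x"
    by (simp add: algebra_simps)
qed

text \<open>The induction goes in steps of two, since J respects z w z but not products.\<close>

lemma J_power: "J (x ^ n) = J x ^ n"
proof (induction n rule: less_induct)
  case (less n)
  consider "n = 0" | "n = 1" | k where "n = Suc (Suc k)"
    by (metis One_nat_def not0_implies_Suc)
  then show ?case
  proof cases
    case 3
    have "z ^ n = z * z ^ k * z" for z :: 'a
      unfolding 3 by (simp add: mult.assoc power_commutes)
    then show ?thesis using J_triple less[of k] 3 by simp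
  qed (simp_all add: J_one)
qed

lemma J_corner: "x \<in> corner f \<Longrightarrow> f * f = f \<Longrightarrow> J x \<in> corner (J f)"
proof -
  assume x: "x \<in> corner f" and f: "f * f = f"
  have "f * x * f = x" using x by (simp add: corner_def)
  then have "J f * J x * J f = J x" using J_triple by metis
  moreover have "J f * J f = J f" using J_square[of f] f by simp
  ultimately show ?thesis using cornerI by metis
qed

text \<open>x = [g, x]. For X = J x and G = J g, the Jordan identities give X = G X + X G and G X G
  = 0, so both summands are commutators with G.\<close>

lemma offdiag_in_K:
  assumes g: "g * g = g" and x: "g * x = x" "x * g = 0"
  shows "x \<in> K" "J x \<in> K"
proof -
  show "x \<in> K" using K_commutator[of g x] x by simp
  define G X where "G = J g" and "X = J x"
  have GG: "G * G = G" using J_square[of g] g by (simp add: G_def)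
  have X: "X = G * X + X * G" using J_jordan[of g x] x by (simp add: G_def X_def)
  have GXG: "G * X * G = 0" using J_triple[of g x] x by (simp add: G_def X_def J.zero)
  have "G * X \<in> K"
    using K_commutator[of G "G * X"] GG GXG by (simp add: mult.assoc[symmetric])
  moreover have "X * G \<in> K"
    using K_commutator[of "X * G" G] GG GXG by (simp add: mult.assoc)
  ultimately show "J x \<in> K" using X K_add unfolding X_def by metis
qed

text \<open>The idempotents \<open>f\<close> and \<open>J f\<close> are equivalent:
  \<open>q * p = f\<close> and \<open>p * q = J f\<close>. So \<theta> brings J back into the
  division ring fAf, changing its values on the corner only by commutators, and there \<theta> x is
  a conjugate of x.\<close>

lemma primitive_mod_K:
  assumes M: "mult_map J"
    and f: "f * f = f" "f \<noteq> 0" and prim: "\<And>g. g \<in> corner f \<Longrightarrow> g * g = g \<Longrightarrow> g = 0 \<or> g = f"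
    and x: "x \<in> corner f"
  shows "J x - x \<in> K"
proof -
  define G where "G = J f"
  have GG: "G * G = G" using J_square[of f] f by (simp add: G_def)
  have "G \<noteq> 0" using J_inj[of f 0] f by (simp add: G_def J.zero)
  have inv: "\<exists>y\<in>corner f. y * x = f" if "x \<in> corner f" "x \<noteq> 0" for x
    using corner_inverse[OF f(1) prim that] by metis
  \<comment> \<open>\<open>G\<close> is the value at \<open>f\<close> of a map in M(A), so GAf = 0
    would give \<open>G * G = 0\<close>.\<close>
  have "\<exists>w. G * w * f \<noteq> 0"
  proof (rule ccontr)
    assume "\<not> ?thesis"
    then have zero: "G * w * f = 0" for w by blast
    have "G * h f = 0" if "mult_map h" for h
      using that
    proof induction
      case (mult_map_base a b)
      then show ?case using zero[of a] by (simp add: mult.assoc[symmetric])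
    qed (simp add: distrib_left)
    then show False using M GG \<open>G \<noteq> 0\<close> by (simp add: G_def)
  qed
  then obtain w where w: "G * w * f \<noteq> 0" by blast
  define p where "p = G * w * f"
  have p: "G * p = p" "p * f = p" using GG f by (simp_all add: p_def mult.assoc) (simp add: mult.assoc[symmetric])
  obtain s where s: "p * s * p \<noteq> 0" using semiprime w p_def by blast
  define d where "d = f * s * p"
  have "p * d \<noteq> 0" using s p by (simp add: d_def mult.assoc[symmetric])
  then have "d \<noteq> 0" by auto
  moreover have d: "d \<in> corner f"
    using f p by (simp add: d_def corner_def mult.assoc) (simp add: mult.assoc[symmetric])
  ultimately obtain d' where d': "d' \<in> corner f" "d' * d = f" using inv by blast
  define q where "q = d' * f * s * G"
  have q: "f * q = q" "q * G = q"
    using d'(1) GG by (simp_all add: q_def corner_def mult.assoc) (simp add: mult.assoc[symmetric])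
  have qp: "q * p = f" using d' p by (simp add: q_def d_def mult.assoc)
  define h where "h = p * q"
  have h: "h \<in> corner G" "h * h = h" "h \<noteq> 0"
  proof -
    show "h \<in> corner G"
      using p q by (simp add: h_def corner_def mult.assoc) (simp add: mult.assoc[symmetric])
    have "h * h = p * (q * p) * q" by (simp add: h_def mult.assoc)
    then show hh: "h * h = h" using qp p by (simp add: h_def)
    have "q * h * p = f" using qp f by (simp add: h_def mult.assoc[symmetric]) (simp add: mult.assoc qp)
    then show "h \<noteq> 0" using f by auto
  qed
  \<comment> \<open>\<open>J\<close> carries the corner of \<open>f\<close> onto that of
    \<open>G\<close>, so \<open>G\<close> is primitive as well and the nonzero idempotent
    \<open>h\<close> must be \<open>G\<close>.\<close>
  have pq: "p * q = G"
  proof -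
    obtain y where y: "h = J y" using J_surj by blast
    define y' where "y' = f * y * f"
    have y': "y' \<in> corner f" "J y' = h"
      using cornerI[OF f(1)] h(1) by (simp_all add: y'_def J_triple G_def[symmetric] y[symmetric] corner_def)
    have "J (y' * y') = J y'" using y'(2) h(2) J_square by simp
    then have "y' * y' = y'" by (simp only: J_inj)
    then have "y' = 0 \<or> y' = f" using prim y'(1) by blast
    then show ?thesis using y'(2) h(3) by (auto simp: G_def[symmetric] h_def[symmetric] J.zero)
  qed
  define \<theta> where "\<theta> z = q * J z * p" for z
  have \<theta>_corner: "\<theta> z \<in> corner f" for z
    using q p by (simp add: \<theta>_def corner_def mult.assoc) (simp add: mult.assoc[symmetric])
  have \<theta>_cong: "J z - \<theta> z \<in> K" if "z \<in> corner f" for z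
  proof -
    have "J z * G = J z" using J_corner[OF that f(1)] by (simp add: corner_def G_def)
    then have "(J z * p) * q - q * (J z * p) = J z - \<theta> z" by (simp add: mult.assoc pq \<theta>_def)
    then show ?thesis using K_commutator by metis
  qed
  have \<theta>_add: "\<theta> (a + b) = \<theta> a + \<theta> b" for a b
    by (simp add: \<theta>_def J.add distrib_left distrib_right)
  have \<theta>_sum: "\<theta> (\<Sum>i\<in>I. g i) = (\<Sum>i\<in>I. \<theta> (g i))" for g :: "nat \<Rightarrow> 'a" and I
    by (simp add: \<theta>_def J.sum sum_distrib_left sum_distrib_right)
  \<comment> \<open>This is where membership in M(A) enters: in each summand
    \<open>q * a * z * b * p\<close> the central \<open>c\<close> passes \<open>q * a * f\<close>,
    an element of the corner.\<close>
  have \<theta>_central: "\<theta> (c * z) = c * \<theta> z"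
    if c: "c \<in> corner f" "\<And>d. d \<in> corner f \<Longrightarrow> c * d = d * c" and z: "f * z = z" "z * f = z" for c z
  proof -
    have "q * h (c * z) * p = c * (q * h z * p)" if "mult_map h" for h
      using that
    proof induction
      case (mult_map_base a b)
      have "f * (q * a) * f \<in> corner f" using cornerI[OF f(1)] .
      then have "c * (f * (q * a) * f) = f * (q * a) * f * c" using c(2) by blast
      then have *: "c * (q * a * f) = q * a * c"
        using q(1) c(1) by (simp add: mult.assoc corner_def) (simp add: mult.assoc[symmetric] q(1))
      have "q * (a * (c * z) * b) * p = (q * a * c) * z * b * p" by (simp add: mult.assoc)
      also have "\<dots> = c * (q * a * (f * z) * b * p)" unfolding *[symmetric] by (simp add: mult.assoc)
      finally show ?case using z by (simp add: mult.assoc)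
    qed (simp add: distrib_left distrib_right)
    then show ?thesis using M by (simp add: \<theta>_def)
  qed
  have \<theta>_f: "\<theta> f = f" using p qp by (simp add: \<theta>_def G_def[symmetric] mult.assoc)
  \<comment> \<open>Exponents start at one because \<theta> sends 1 to
    \<open>q * p = f\<close>.\<close>
  have \<theta>_power: "\<theta> x ^ Suc k = \<theta> (x ^ Suc k)" for k
  proof (induction k)
    case (Suc k)
    have "J x * G = J x" using J_corner[OF x f(1)] by (simp add: corner_def G_def)
    then have "\<theta> x * \<theta> (x ^ Suc k) = q * J x * J (x ^ Suc k) * p"
      unfolding \<theta>_def by (simp add: mult.assoc[symmetric]) (simp add: mult.assoc pq[symmetric])
    also have "\<dots> = \<theta> (x ^ Suc (Suc k))" unfolding \<theta>_def J_power by (simp add: mult.assoc)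
    finally show ?case using Suc by simp
  qed simp
  obtain u where u: "u \<in> corner f" "u \<noteq> 0" "\<theta> x * u = u * x"
  proof (rule division_intertwiner[OF f inv x \<theta>_corner])
    fix m c
    assume c: "\<And>k. k \<le> m \<Longrightarrow> c k \<in> corner f"
      and central: "\<And>k d. k \<le> m \<Longrightarrow> d \<in> corner f \<Longrightarrow> c k * d = d * c k"
      and rel: "(\<Sum>k\<le>m. c k * x ^ k) = 0"
    have term_eq: "\<theta> (c k * x ^ k) = c k * \<theta> x ^ k" if k: "k \<le> m" for k
    proof (cases k)
      case 0
      have "\<theta> (c 0 * f) = c 0 * \<theta> f" using 0 k c central f(1) by (intro \<theta>_central) auto
      then show ?thesis using c[of 0] 0 \<theta>_f by (simp add: corner_def)
    next
      case (Suc i)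
      have "x ^ Suc i \<in> corner f" using corner_mult_power[OF x x, of i] by simp
      then show ?thesis
        unfolding Suc \<theta>_power using k Suc c central
        by (intro \<theta>_central) (auto simp: corner_def)
    qed
    have "(\<Sum>k\<le>m. c k * \<theta> x ^ k) = \<theta> (\<Sum>k\<le>m. c k * x ^ k)" using term_eq by (simp add: \<theta>_sum)
    also have "\<dots> = 0" unfolding rel by (simp add: \<theta>_def J.zero)
    finally show "(\<Sum>k\<le>m. c k * \<theta> x ^ k) = 0" .
  qed blast
  obtain u' where u': "u' \<in> corner f" "u * u' = f" "u' * u = f"
    using corner_inverse[OF f(1) prim u(1,2)] by metis
  have "\<theta> x = \<theta> x * u * u'" using u'(2) \<theta>_corner[of x] by (simp add: mult.assoc corner_def)
  then have "(u * x) * u' = \<theta> x" using u(3) by simp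
  moreover have "u' * (u * x) = x" using u'(3) x by (simp add: mult.assoc[symmetric] corner_def)
  ultimately have "\<theta> x - x \<in> K" using K_commutator[of "u * x" u'] by simp
  then show ?thesis using K_add[OF \<theta>_cong[OF x]] by fastforce
qed

text \<open>Induction on the dimension of fA: an idempotent strictly between 0 and \<open>f\<close>
  leaves two components in smaller corners and two off-diagonal ones, which lie in [A,A] together
  with their images.\<close>

lemma corner_mod_K:
  assumes M: "mult_map J"
  shows "f * f = f \<Longrightarrow> x \<in> corner f \<Longrightarrow> J x - x \<in> K"
proof (induction "dim (range ((*) f))" arbitrary: f x rule: less_induct)
  case less
  note f = less.prems(1) and x = less.prems(2)
  have smaller: "dim (range ((*) g)) < dim (range ((*) f))"
    if g: "g \<in> corner f" "g * g = g" "g \<noteq> f" for g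
  proof -
    have "range ((*) g) \<subseteq> range ((*) f)"
      using g(1) by (auto simp: corner_def) (metis mult.assoc rangeI)
    moreover have "range ((*) g) \<noteq> range ((*) f)"
    proof
      assume "range ((*) g) = range ((*) f)"
      then have "f \<in> range ((*) g)" using f by (metis rangeI)
      then obtain b where "f = g * b" by blast
      then have "g * f = f" using g(2) by (simp add: mult.assoc[symmetric])
      then show False using g by (simp add: corner_def)
    qed
    ultimately have "range ((*) g) \<subset> range ((*) f)" by blast
    then show ?thesis
      using dim_psubset[of "range ((*) g)" "range ((*) f)"] range_mult_subspace by (simp add: span_eq_iff[THEN iffD2])
  qed
  show ?case
  proof (cases "\<exists>g. g \<in> corner f \<and> g * g = g \<and> g \<noteq> 0 \<and> g \<noteq> f")
    case True
    then obtain g where g: "g \<in> corner f" "g * g = g" "g \<noteq> 0" "g \<noteq> f" by blast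
    define h where "h = f - g"
    have fg: "f * g = g" "g * f = g" using g(1) by (simp_all add: corner_def)
    have gh: "g * h = 0" "h * g = 0" using g fg by (simp_all add: h_def algebra_simps)
    have h: "h \<in> corner f" "h * h = h" "h \<noteq> f"
      using g fg f by (simp_all add: h_def corner_def algebra_simps)
    have split: "x = g * x * g + g * x * h + h * x * g + h * x * h"
    proof -
      have "f * x * f = x" using x by (simp add: corner_def)
      then show ?thesis by (simp add: h_def algebra_simps)
    qed
    have gg: "J (g * x * g) - g * x * g \<in> K"
      using less.hyps[OF smaller[OF g(1,2,4)] g(2)] cornerI[OF g(2)] by blast
    have hh: "J (h * x * h) - h * x * h \<in> K"
      using less.hyps[OF smaller[OF h] h(2)] cornerI[OF h(2)] by blast
    have "g * (g * x * h) = g * x * h" "g * x * h * g = 0"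
      using g gh by (simp_all add: mult.assoc) (simp add: mult.assoc[symmetric])
    note 1 = offdiag_in_K[OF g(2) this]
    have "h * (h * x * g) = h * x * g" "h * x * g * h = 0"
      using h gh by (simp_all add: mult.assoc) (simp add: mult.assoc[symmetric])
    note 2 = offdiag_in_K[OF h(2) this]
    have "J x - x = (J (g * x * g) - g * x * g) + (J (g * x * h) - g * x * h)
        + (J (h * x * g) - h * x * g) + (J (h * x * h) - h * x * h)"
      by (subst (1 2) split) (simp only: J.add, simp add: algebra_simps)
    then show ?thesis using gg hh 1 2 by (simp only: K_add K_diff)
  next
    case False
    show ?thesis
    proof (cases "f = 0")
      case True
      then show ?thesis using x by (simp add: corner_def J.zero K_zero)
    next
      case ne: False
      show ?thesis using primitive_mod_K[OF M f ne _ x] False by blast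
    qed
  qed
qed

theorem jordan_mod_commutators: "mult_map J \<Longrightarrow> J x - x \<in> K"
  by (rule corner_mod_K[of 1]) (simp_all add: corner_def)

end

section \<open>Cubic trace preservers\<close>

lemma K_swap: "x * y \<in> K \<Longrightarrow> y * x \<in> K"
  using K_diff[OF _ K_commutator[of x y]] by fastforce

text \<open>D = [m, _] is a derivation that kills commutators. Applied to [x, x y] = x [x, y] it
  gives D x [x, y] = 0; comparing y with y m yields D x y D x = 0.\<close>

lemma central_if_commutes_with_commutators:
  fixes m :: 'a
  assumes "\<And>x y. m * (x * y - y * x) = (x * y - y * x) * m"
  shows "m \<in> center"
proof (rule centerI)
  fix x
  define D where "D y = m * y - y * m" for y
  have D0: "D (x * y - y * x) = 0" for y using assms by (simp add: D_def)
  have 1: "D x * (x * y - y * x) = 0" for y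
  proof -
    have "D (x * (x * y) - (x * y) * x) = D x * (x * y - y * x) + x * D (x * y - y * x)"
      by (simp add: D_def algebra_simps)
    then show ?thesis using D0[of y] D0[of "x * y"] by simp
  qed
  have "D x * y * D x = 0" for y
  proof -
    have "D x * y * D x = D x * (x * y - y * x) * m - D x * (x * (y * m) - (y * m) * x)"
      by (simp add: D_def algebra_simps)
    then show ?thesis by (simp add: 1)
  qed
  then have "D x = 0" by (rule semiprime)
  then show "m * x = x * m" by (simp add: D_def)
qed

section \<open>Consequences of the polarised cubic condition\<close>

context
  fixes T
  assumes T_linear: "Vector_Spaces.linear scale scale T"
    and T_cube: "\<And>x. T x ^ 3 - x ^ 3 \<in> K"
begin

interpretation T: Vector_Spaces.linear scale scale T
  by (rule T_linear)

text \<open>Full polarisation of the cube is the sum of the six orderings of a product. Modulo [A,A]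
  cyclic shifts agree, so it equals 3 (pq + qp) r, and 3 is invertible.\<close>

lemma T_trilinear: "(T x * T y + T y * T x) * T z - (x * y + y * x) * z \<in> K"
proof (rule K_third)
  define S :: "'a \<Rightarrow> 'a \<Rightarrow> 'a \<Rightarrow> 'a" where
    "S p q r = p * q * r + p * r * q + q * p * r + q * r * p + r * p * q + r * q * p" for p q r
  define W :: "'a \<Rightarrow> 'a \<Rightarrow> 'a \<Rightarrow> 'a" where "W p q r = (p * q + q * p) * r" for p q r
  have polar: "(p + q + r) ^ 3 - (p + q) ^ 3 - (p + r) ^ 3 - (q + r) ^ 3 + p ^ 3 + q ^ 3 + r ^ 3 = S p q r"
    for p q r :: 'a
    by (simp add: S_def power3_eq_cube algebra_simps)
  define g where "g x = T x ^ 3 - x ^ 3" for x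
  have "S (T x) (T y) (T z) - S x y z =
      g (x + y + z) - g (x + y) - g (x + z) - g (y + z) + g x + g y + g z"
    unfolding polar[symmetric] g_def T.add by (simp add: algebra_simps)
  then have S: "S (T x) (T y) (T z) - S x y z \<in> K"
    using T_cube by (simp only: g_def K_add K_diff)
  have W: "S p q r - (W p q r + W p q r + W p q r) \<in> K" for p q r
  proof -
    have "S p q r - (W p q r + W p q r + W p q r) =
        ((q * r) * p - p * (q * r)) + (r * (p * q) - (p * q) * r)
        + ((p * r) * q - q * (p * r)) + (r * (q * p) - (q * p) * r)"
      by (simp add: S_def W_def algebra_simps)
    then show ?thesis using K_commutator by (simp only: K_add)
  qed
  define w where "w = W (T x) (T y) (T z) - W x y z"
  have "w + w + w = (S (T x) (T y) (T z) - S x y z)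
      - (S (T x) (T y) (T z) - (W (T x) (T y) (T z) + W (T x) (T y) (T z) + W (T x) (T y) (T z)))
      + (S x y z - (W x y z + W x y z + W x y z))"
    by (simp add: w_def algebra_simps)
  also have "\<dots> \<in> K" by (rule K_add[OF K_diff[OF S W] W])
  finally show "(T x * T y + T y * T x) * T z - (x * y + y * x) * z
    + ((T x * T y + T y * T x) * T z - (x * y + y * x) * z)
    + ((T x * T y + T y * T x) * T z - (x * y + y * x) * z) \<in> K"
    by (simp only: w_def W_def)
qed

lemma eq_zero_if_double_mult_in_K:
  fixes x :: 'a
  assumes "\<And>z. (x + x) * z \<in> K"
  shows "x = 0"
proof (rule nondegenerate)
  fix z
  show "x * z \<in> K" using assms[of z, unfolded distrib_right] by (rule K_half)
qed

lemma T_kernel: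
  assumes "T x = 0"
  shows "x = 0"
proof (rule eq_zero_if_double_mult_in_K)
  fix z
  have "- ((z * 1 + 1 * z) * x) \<in> K" using T_trilinear[of z 1 x] assms by simp
  then have "(z + z) * x \<in> K" using K_diff[OF K_zero] by fastforce
  then have "x * (z + z) \<in> K" by (rule K_swap)
  then show "(x + x) * z \<in> K" by (simp add: distrib_left distrib_right)
qed

lemma T_surj: "\<exists>x. T x = y"
proof -
  have "inj T"
  proof (rule injI)
    fix x y assume "T x = T y"
    then show "x = y" using T_kernel[of "x - y"] by (simp add: T.diff)
  qed
  then have "surj T" using linear_inj_imp_surj[OF T_linear] by blast
  then show ?thesis by (metis surjD)
qed

lemma T_cancel:
  fixes w :: 'a
  assumes "\<And>z. w * T z \<in> K"
  shows "w = 0"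
  using assms T_surj nondegenerate by metis

definition a where "a = T 1"
definition A where "A w = a * w + w * a"
definition C where "C w = a * w - w * a"

lemma A_scale: "A (scale c w) = scale c (A w)"
  by (simp add: A_def scale_mult_left[symmetric] scale_mult_right[symmetric] scale_right_distrib)

lemma A_diff: "A (v - w) = A v - A w" and A_zero: "A 0 = 0"
  by (simp_all add: A_def algebra_simps)

lemma C_scale: "C (scale c w) = scale c (C w)"
  by (simp add: C_def scale_mult_left[symmetric] scale_mult_right[symmetric] scale_right_diff_distrib)

lemma C_diff: "C (v - w) = C v - C w"
  by (simp add: C_def algebra_simps)

lemma C_add: "C (v + w) = C v + C w"
  by (simp add: C_def algebra_simps)

lemma C_mult: "C (v * w) = C v * w + v * C w"
  by (simp add: C_def algebra_simps)

text \<open>Trilinearity at (x, y, z) and at (x o y, 1, z) determines the same class (x o y) z, up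
  to a factor 2.\<close>

lemma star: "scale 2 (T x * T y + T y * T x) = A (T (x * y + y * x))"
proof -
  define u where "u = T x * T y + T y * T x"
  define v where "v = x * y + y * x"
  have "(u + u) - A (T v) = 0"
  proof (rule T_cancel)
    fix z
    have 1: "u * T z - v * z \<in> K" unfolding u_def v_def by (rule T_trilinear)
    have 2: "(T v * T 1 + T 1 * T v) * T z - (v * 1 + 1 * v) * z \<in> K" by (rule T_trilinear)
    have "((u + u) - A (T v)) * T z = (u * T z - v * z) + (u * T z - v * z)
      - ((T v * T 1 + T 1 * T v) * T z - (v * 1 + 1 * v) * z)"
      by (simp add: A_def a_def algebra_simps)
    also have "\<dots> \<in> K" by (rule K_diff[OF K_add[OF 1 1] 2])
    finally show "((u + u) - A (T v)) * T z \<in> K" .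
  qed
  then show ?thesis by (simp add: scale_two u_def v_def)
qed

lemma star_commute:
  assumes "x * y = y * x"
  shows "T x * T y + T y * T x = A (T (x * y))"
proof -
  have "x * y + y * x = scale 2 (x * y)" by (simp add: scale_two assms)
  then have "scale 2 (T x * T y + T y * T x) = scale 2 (A (T (x * y)))"
    using star[of x y] by (simp only: T.scale A_scale)
  then show ?thesis using two scale_cancel_left by blast
qed

text \<open>For w = T x, trilinearity at (x, 1, z) turns A w T z into 2 x z. This injectivity stands
  in for division by left plus right multiplication by a.\<close>

lemma A_cancel:
  assumes "A w = 0"
  shows "w = 0"
proof -
  obtain x where x: "T x = w" using T_surj by blast
  have "x = 0"
  proof (rule eq_zero_if_double_mult_in_K)
    fix z
    have "A w * T z - (x * 1 + 1 * x) * z \<in> K"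
      using T_trilinear[of x 1 z] by (simp add: A_def a_def x add.commute)
    then have "- ((x + x) * z) \<in> K" using assms by simp
    then show "(x + x) * z \<in> K" using K_diff[OF K_zero] by fastforce
  qed
  then show ?thesis using x T.zero by simp
qed

text \<open>A posteriori this is the inverse of \<open>a\<close>; while centrality of
  \<open>a\<close> is open, its powers supply the relations that make \<open>a\<close>
  invertible.\<close>

definition x0 where "x0 = (SOME x. T x = 1)"

lemma T_x0: "T x0 = 1"
  unfolding x0_def using T_surj by (rule someI_ex)

text \<open>As x o \<zeta>y = \<zeta>x o y, the product T x o T(\<zeta>y) is symmetric in x and y.
  Taking y = x0 gives 2 T(\<zeta>x) = m o T x, and substituting this back shows that m commutes with
  all commutators, hence is central.\<close>

lemma T_center:
  assumes z: "\<zeta> \<in> center"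
  shows "T (\<zeta> * x) = \<zeta> * T x"
proof -
  have swap: "T x * T (\<zeta> * y) + T (\<zeta> * y) * T x = T (\<zeta> * x) * T y + T y * T (\<zeta> * x)" for x y
  proof -
    have "(T x * T (\<zeta> * y) + T (\<zeta> * y) * T x) - (T (\<zeta> * x) * T y + T y * T (\<zeta> * x)) = 0"
    proof (rule T_cancel)
      fix z
      have "x * (\<zeta> * y) + (\<zeta> * y) * x = (\<zeta> * x) * y + y * (\<zeta> * x)"
      proof -
        have "x * (\<zeta> * y) = (\<zeta> * x) * y"
          by (simp only: mult.assoc[symmetric] centerD[OF z, of x])
        moreover have "(\<zeta> * y) * x = y * (\<zeta> * x)"
          by (simp only: mult.assoc[symmetric] centerD[OF z, of y])
        ultimately show ?thesis by simp
      qed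
      then have "((T x * T (\<zeta> * y) + T (\<zeta> * y) * T x) - (T (\<zeta> * x) * T y + T y * T (\<zeta> * x))) * T z
        = ((T x * T (\<zeta> * y) + T (\<zeta> * y) * T x) * T z - (x * (\<zeta> * y) + (\<zeta> * y) * x) * z)
        - ((T (\<zeta> * x) * T y + T y * T (\<zeta> * x)) * T z - ((\<zeta> * x) * y + y * (\<zeta> * x)) * z)"
        by (simp only: left_diff_distrib) simp
      also have "\<dots> \<in> K" by (rule K_diff[OF T_trilinear T_trilinear])
      finally show "((T x * T (\<zeta> * y) + T (\<zeta> * y) * T x) - (T (\<zeta> * x) * T y + T y * T (\<zeta> * x))) * T z \<in> K" .
    qed
    then show ?thesis by simp
  qed
  define m where "m = T (\<zeta> * x0)"
  have m: "T (\<zeta> * x) + T (\<zeta> * x) = m * T x + T x * m" for x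
    using swap[of x x0] by (simp add: T_x0 m_def add.commute)
  have m_center: "m \<in> center"
  proof (rule central_if_commutes_with_commutators)
    fix w v
    obtain x y where xy: "T x = w" "T y = v" using T_surj by metis
    have "w * (m * v + v * m) + (m * v + v * m) * w = (m * w + w * m) * v + v * (m * w + w * m)"
      using arg_cong2[OF swap[of x y] swap[of x y], of "(+)"]
      unfolding xy[symmetric] m[symmetric] by (simp add: algebra_simps)
    moreover have "(w * v - v * w) * m - m * (w * v - v * w) =
      (w * (m * v + v * m) + (m * v + v * m) * w) - ((m * w + w * m) * v + v * (m * w + w * m))"
      by (simp add: algebra_simps)
    ultimately show "m * (w * v - v * w) = (w * v - v * w) * m" by simp
  qed
  have T_m: "T (\<zeta> * x) = m * T x" for x
  proof (rule double_eq)
    show "T (\<zeta> * x) + T (\<zeta> * x) = m * T x + m * T x"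
      unfolding m using centerD[OF m_center, of "T x"] by simp
  qed
  \<comment> \<open>Trilinearity at (x0, x0, \<zeta>y), compared with \<zeta> times trilinearity at
    (x0, x0, y), gives 2 m w ~ 2 \<zeta> w.\<close>
  have "m - \<zeta> = 0"
  proof (rule eq_zero_if_double_mult_in_K)
    fix w
    obtain y where y: "T y = w" using T_surj by blast
    define S where "S = x0 * x0 + x0 * x0"
    have 1: "(m * w + m * w) - S * (\<zeta> * y) \<in> K"
      using T_trilinear[of x0 x0 "\<zeta> * y"]
      by (simp only: T_x0 T_m y S_def[symmetric] mult_1_left distrib_right[of 1 1])
    have 2: "\<zeta> * ((w + w) - S * y) \<in> K"
      using K_center[OF z T_trilinear[of x0 x0 y]]
      by (simp only: T_x0 y S_def[symmetric] mult_1_left distrib_right[of 1 1])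
    have "\<zeta> * (S * y) = S * (\<zeta> * y)"
      by (simp only: mult.assoc[symmetric] centerD[OF z, of S])
    then have "((m - \<zeta>) + (m - \<zeta>)) * w = ((m * w + m * w) - S * (\<zeta> * y)) - \<zeta> * ((w + w) - S * y)"
      by (simp add: algebra_simps)
    also have "\<dots> \<in> K" using 1 2 by (rule K_diff)
    finally show "((m - \<zeta>) + (m - \<zeta>)) * w \<in> K" .
  qed
  then show ?thesis using T_m by simp
qed

lemma T_mult_map: "mult_map T"
  using T.add T_center by (rule center_linear_mult_map)

definition e where "e = T (x0 * x0)"

text \<open>Splitting x0^4 as x0^2 x0^2 and as x0 x0^3 gives T(x0^3) = e^2, and then e a e = e. Thus
  a e = 1 - R and e a = 1 + R are both idempotent, which forces 2 R = 0.\<close>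

lemma T_x0_cube: "T (x0 * (x0 * x0)) = e * e"
  and a_e: "a * e = 1" and e_a: "e * a = 1"
proof -
  define r where "r = T (x0 * (x0 * x0))"
  define s where "s = T (x0 * (x0 * (x0 * x0)))"
  have 1: "A e = 1 + 1"
    using star_commute[of x0 x0] by (simp add: T_x0 e_def)
  have 2: "A r = e + e"
    using star_commute[of x0 "x0 * x0"] by (simp add: T_x0 e_def r_def mult.assoc)
  have 3: "A s = e * e + e * e"
    using star_commute[of "x0 * x0" "x0 * x0"] by (simp add: e_def s_def mult.assoc)
  have 4: "A s = r + r"
    using star_commute[of x0 "x0 * (x0 * x0)"] by (simp add: T_x0 r_def s_def mult.assoc)
  have r: "r = e * e" using 3 4 double_eq by metis
  then show "T (x0 * (x0 * x0)) = e * e" by (simp add: r_def)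
  have eae: "e * a * e = e"
  proof (rule double_eq)
    have "(e * a * e + e * a * e) + A r = e * A e + A e * e"
      by (simp add: r A_def algebra_simps)
    then have "(e * a * e + e * a * e) + (e + e) = (e + e) + (e + e)"
      by (simp only: 1 2 distrib_left distrib_right mult_1_left mult_1_right)
    then show "e * a * e + e * a * e = e + e" by (simp only: add_right_cancel)
  qed
  define R where "R = 1 - a * e"
  have ea: "e * a = 1 + R" using 1 by (simp add: A_def R_def algebra_simps)
  have "(a * e) * (a * e) = a * e" using eae by (simp add: mult.assoc)
  then have RR: "R * R = R" by (simp add: R_def algebra_simps)
  have "(e * a) * (e * a) = e * a" using eae by (simp add: mult.assoc[symmetric])
  then have "R + R = 0" by (simp add: ea RR distrib_left distrib_right)
  then have "R = 0" by (rule double_zero)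
  then show "a * e = 1" "e * a = 1" using ea by (simp_all add: R_def)
qed

text \<open>Let $l, r$ be left and right multiplication by $x_0$, and $\lambda, \rho$ those by $a$.
  Conjugation by $T$ turns the power sums $l^k + r^k$, $k \le 3$, into
  $2(\lambda+\rho)^{-1}(\lambda^{1-k} + \rho^{1-k})$, so Newton's identity
  $2p_3 = 3p_1p_2 - p_1^3$ becomes an identity between $\lambda$ and $\rho$. Cleared of
  denominators it reads $(\lambda - \rho)^4 = 0$.\<close>

lemma C_nilpotent: "C (C (C (C u))) = 0"
proof -
  have rel: "A (A (e * e * v + v * (e * e))) - scale 6 (A (e * v + v * e)) + scale 16 v = 0" for v
  proof -
    obtain y where y: "T y = v" using T_surj by blast
    define p1 p2 p3 where "p1 w = x0 * w + w * x0" and "p2 w = x0 * x0 * w + w * (x0 * x0)"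
      and "p3 w = x0 * (x0 * x0) * w + w * (x0 * (x0 * x0))" for w
    have A1: "A (T (p1 w)) = scale 4 (T w)" for w
      using star[of x0 w] by (simp add: p1_def T_x0 scale_two[symmetric])
    have A2: "A (T (p2 y)) = scale 2 (e * v + v * e)"
      using star[of "x0 * x0" y] by (simp add: p2_def e_def y)
    have A3: "A (T (p3 y)) = scale 2 (e * e * v + v * (e * e))"
      using star[of "x0 * (x0 * x0)" y] by (simp only: p3_def T_x0_cube y)
    \<comment> \<open>Newton's identity for two commuting quantities, whose third elementary
      symmetric function is zero.\<close>
    have "p3 y + p3 y = p1 (p2 y) + p1 (p2 y) + p1 (p2 y) - p1 (p1 (p1 y))"
      by (simp add: p1_def p2_def p3_def algebra_simps)
    then have "scale 2 (p3 y) = scale 3 (p1 (p2 y)) - p1 (p1 (p1 y))"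
      by (simp only: scale_two scale_three)
    then have "A (A (A (T (scale 2 (p3 y))))) = A (A (A (T (scale 3 (p1 (p2 y)) - p1 (p1 (p1 y))))))"
      by simp
    then have "scale 4 (A (A (e * e * v + v * (e * e)))) = scale 24 (A (e * v + v * e)) - scale 64 v"
      by (simp add: T.diff T.scale A_diff A_scale A1 A2 A3 y)
    then have "scale 4 (A (A (e * e * v + v * (e * e))) - scale 6 (A (e * v + v * e)) + scale 16 v) = 0"
      by (simp add: scale_right_distrib scale_right_diff_distrib)
    moreover have "(4::'k) \<noteq> 0" using two by (metis mult_2 mult_eq_0_iff numeral_Bit0)
    ultimately show ?thesis using scale_eq_0_iff by blast
  qed
  \<comment> \<open>v = \<lambda>^2 \<rho>^2 u clears every \<open>e\<close>. With s = \<lambda> +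
    \<rho> and t = \<lambda> \<rho>, the relation becomes s^4 - 8 t s^2 + 16 t^2 = (s^2 - 4 t)^2 =
    (\<lambda> - \<rho>)^4 applied to u.\<close>
  define v where "v = a * (a * (u * (a * a)))"
  have cancel: "e * (a * w) = w" "w * (a * e) = w" for w
    using e_a a_e by (simp_all add: mult.assoc[symmetric])
  have ev: "e * v = a * (u * (a * a))" "v * e = a * (a * (u * a))"
    "e * e * v = u * (a * a)" "v * (e * e) = a * (a * u)"
    using a_e by (simp_all add: v_def mult.assoc cancel) (simp_all add: mult.assoc[symmetric] a_e cancel)
  define w where "w = A (e * v + v * e)"
  have six: "scale 6 w = w + w + w + (w + w + w)"
  proof -
    have "scale 6 w = scale (3 + 3) w" by simp
    then show ?thesis by (simp only: scale_left_distrib scale_three)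
  qed
  have sixteen: "scale 16 v = scale 2 (scale 2 (scale 2 (scale 2 v)))" by simp
  have "C (C (C (C u))) = A (A (e * e * v + v * (e * e))) - scale 6 w + scale 16 v"
    unfolding six sixteen scale_two unfolding w_def ev unfolding v_def A_def C_def by (simp add: algebra_simps)
  then show ?thesis using rel[of v] by (simp add: w_def)
qed

text \<open>q = T g and p = T(1 - g) anticommute and add up to a. Hence A (p q) = 0, so p q = q p =
  0 and a q = q q = q a.\<close>

lemma commutes_T_idempotent:
  assumes g: "g * g = g"
  shows "C (T g) = 0" "(e * T g) * (e * T g) = e * T g" "T (1 - g) = a * (1 - e * T g)"
    and "a * (e * T g) = (e * T g) * a"
proof -
  define q p where "q = T g" and "p = T (1 - g)"
  have a: "a = p + q" by (simp add: p_def q_def a_def T.diff)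
  have "q * p + p * q = A (T (g * (1 - g)))"
    unfolding q_def p_def using g by (intro star_commute) (simp add: algebra_simps)
  then have anti: "q * p = - (p * q)"
    using g by (simp add: right_diff_distrib T.zero A_zero add_eq_0_iff2)
  have "A (p * q) = p * (p * q) + q * p * q + p * (q * p) + p * (q * q)"
    unfolding A_def a by (simp add: algebra_simps)
  also have "\<dots> = 0" unfolding anti by (simp add: algebra_simps)
  finally have pq: "p * q = 0" by (rule A_cancel)
  then have qp: "q * p = 0" using anti by simp
  have aq: "a * q = q * q" "q * a = q * q" using pq qp by (simp_all add: a algebra_simps)
  then show "C (T g) = 0" by (simp add: C_def q_def)
  have eq: "e * q = q * e"
  proof -
    have "e * q = e * (q * a) * e" using a_e by (simp add: mult.assoc)
    also have "\<dots> = (e * a) * q * e" using aq by (simp add: mult.assoc)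
    finally show ?thesis using e_a by simp
  qed
  have "q * (e * w) = e * (q * w)" for w by (simp only: mult.assoc[symmetric] eq)
  then have "(e * q) * (e * q) = e * (e * (q * q))" by (simp only: mult.assoc)
  also have "\<dots> = e * ((e * a) * q)" using aq(1) by (simp add: mult.assoc)
  finally show "(e * T g) * (e * T g) = e * T g" using e_a by (simp add: q_def)
  have aeq: "a * (e * q) = q" using a_e by (simp add: mult.assoc[symmetric])
  have "(e * q) * a = q" using aq eq e_a by (simp add: mult.assoc)
  then show "a * (e * T g) = (e * T g) * a" using aeq by (simp add: q_def)
  show "T (1 - g) = a * (1 - e * T g)" using aeq a by (simp add: p_def q_def right_diff_distrib)
qed

text \<open>T x anticommutes with p = a (1 - F), where F = e T g. Cancelling the invertible a kills
  the two off-diagonal components of T x with respect to F, and \<open>A_cancel\<close> kills the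
  one in the corner of 1 - F.\<close>

lemma T_corner:
  assumes g: "g * g = g" and x: "x \<in> corner g"
  shows "T x \<in> corner (e * T g)"
proof -
  define F w p where "F = e * T g" and "w = T x" and "p = T (1 - g)"
  note idem = commutes_T_idempotent[OF g, folded F_def p_def]
  have FF: "F * F = F" by (rule idem)
  have aF: "a * F = F * a" by (rule idem)
  have p: "p = a * (1 - F)" by (rule idem)
  have p': "p = (1 - F) * a" using aF by (simp add: p algebra_simps)
  have "T x * T (1 - g) + T (1 - g) * T x = A (T (x * (1 - g)))"
    using x by (intro star_commute) (simp add: corner_def algebra_simps)
  then have anti: "w * p + p * w = 0"
    using x by (simp add: w_def p_def corner_def right_diff_distrib T.zero A_zero)
  have Fp: "F * p = 0" using FF by (simp add: p' mult.assoc[symmetric] right_diff_distrib)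
  have pF: "p * F = 0" using FF by (simp add: p mult.assoc left_diff_distrib)
  have "F * (w * p + p * w) = F * w * (1 - F) * a"
    using Fp by (simp add: distrib_left mult.assoc[symmetric]) (simp add: p' mult.assoc)
  then have "F * w * (1 - F) * a * e = 0" using anti by simp
  then have 1: "F * w * (1 - F) = 0" using a_e by (simp add: mult.assoc)
  have "(w * p + p * w) * F = a * ((1 - F) * w * F)"
    using pF by (simp add: distrib_right mult.assoc) (simp add: p mult.assoc)
  then have "e * (a * ((1 - F) * w * F)) = 0" using anti by simp
  then have 2: "(1 - F) * w * F = 0" using e_a by (simp add: mult.assoc[symmetric])
  have F'p: "(1 - F) * p = p" "p * (1 - F) = p" using Fp pF by (simp_all add: algebra_simps)
  have "A ((1 - F) * w * (1 - F)) = p * w * (1 - F) + (1 - F) * w * p"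
    unfolding A_def by (simp add: mult.assoc p'[symmetric]) (simp add: p mult.assoc[symmetric])
  also have "\<dots> = (1 - F) * (w * p + p * w) * (1 - F)"
    by (simp only: distrib_left distrib_right mult.assoc F'p) (simp only: mult.assoc[symmetric] F'p add.commute)
  finally have "A ((1 - F) * w * (1 - F)) = 0" using anti by simp
  then have 3: "(1 - F) * w * (1 - F) = 0" by (rule A_cancel)
  have 4: "(1 - F) * w = 0" using 2 3 by (simp add: right_diff_distrib)
  have 5: "w * (1 - F) = 0" using 1 3 by (simp add: left_diff_distrib)
  show ?thesis unfolding corner_def F_def[symmetric] w_def[symmetric]
    using 4 5 by (simp add: left_diff_distrib right_diff_distrib)
qed

text \<open>Since x x = 0, x is the difference of the idempotents g + x and g.\<close>

lemma commutes_T_offdiagonal: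
  assumes g: "g * g = g" and x: "g * x = x" "x * g = 0"
  shows "C (T x) = 0"
proof -
  have "x * x = (x * g) * x" using x(1) by (simp add: mult.assoc)
  then have "x * x = 0" using x(2) by simp
  then have "(g + x) * (g + x) = g + x" using g x by (simp add: algebra_simps)
  then have "C (T (g + x)) = 0" by (rule commutes_T_idempotent)
  then show ?thesis using commutes_T_idempotent(1)[OF g] by (simp add: T.add C_add)
qed

text \<open>By \<open>star\<close>, A s is built from T y and T z, so C vanishes on s = T(yz) +
  T(zy). The summands lie in complementary corners, and the idempotent F that separates them
  commutes with a.\<close>

lemma commutes_T_product:
  assumes g: "g * g = g" and y: "g * y = y" "y * g = 0" and z: "z * g = z" "g * z = 0"
  shows "C (T (y * z)) = 0"
proof -
  define h where "h = 1 - g"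
  have h: "h * h = h" using g by (simp add: h_def algebra_simps)
  have hz: "h * z = z" "z * h = 0" using z by (simp_all add: h_def algebra_simps)
  have Cy: "C (T y) = 0" by (rule commutes_T_offdiagonal[OF g y])
  have Cz: "C (T z) = 0" by (rule commutes_T_offdiagonal[OF h hz])
  define s where "s = T (y * z) + T (z * y)"
  have AC: "A (C w) = C (A w)" for w by (simp add: A_def C_def algebra_simps)
  have "A s = scale 2 (T y * T z + T z * T y)" unfolding s_def star T.add ..
  then have "C (A s) = 0" using Cy Cz by (simp add: C_scale C_add C_mult)
  then have Cs: "C s = 0" using A_cancel AC by simp
  define F where "F = e * T g"
  have FF: "F * F = F" and CF: "C F = 0"
    using commutes_T_idempotent[OF g] by (simp_all add: F_def C_def)
  have "y * z \<in> corner g" using y z by (simp add: corner_def mult.assoc) (simp add: mult.assoc[symmetric])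
  then have 1: "T (y * z) \<in> corner F" unfolding F_def by (rule T_corner[OF g])
  have yh: "y * h = y" using y by (simp add: h_def algebra_simps)
  have "z * y \<in> corner h" using hz yh by (simp add: corner_def mult.assoc) (simp add: mult.assoc[symmetric])
  then have "T (z * y) \<in> corner (e * T h)" by (rule T_corner[OF h])
  moreover have "e * T h = 1 - F"
    unfolding h_def commutes_T_idempotent(3)[OF g] F_def using e_a by (simp add: mult.assoc[symmetric])
  ultimately have 2: "F * T (z * y) = 0" by (simp add: corner_def left_diff_distrib)
  have "F * s = T (y * z)" using 1 2 by (simp add: s_def distrib_left corner_def)
  then have "C (T (y * z)) = C F * s + F * C s" using C_mult by metis
  then show ?thesis using CF Cs by simp
qed

text \<open>Extends the vanishing to the whole ideal generated by \<open>k\<close>: the off-diagonal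
  components of b k c are already covered, and each diagonal one is a product of opposite
  off-diagonal elements, because k lies in gA(1-g).\<close>

lemma commutes_T_generated:
  assumes g: "g * g = g" and k: "g * k = k" "k * g = 0" and m: "mult_map m"
  shows "C (T (m k)) = 0"
  using m
proof induction
  case (mult_map_base b c)
  define h where "h = 1 - g"
  have h: "h * h = h" "g * h = 0" "h * g = 0" using g by (simp_all add: h_def algebra_simps)
  have kh: "k * h = k" using k by (simp add: h_def algebra_simps)
  define y z y' z' where "y = g * (b * k)" and "z = h * (c * g)" and "y' = h * (b * g)" and "z' = k * (c * h)"
  have orth: "g * (g * w) = g * w" "h * (h * w) = h * w" "g * (h * w) = 0" "h * (g * w) = 0"
    "k * (g * w) = 0" "k * (h * w) = k * w" "g * (k * w) = k * w" for w
    using g h k kh by (simp_all add: mult.assoc[symmetric])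
  have hk: "h * (k * w) = 0" for w using k by (simp add: h_def left_diff_distrib mult.assoc[symmetric])
  note rules = y_def z_def y'_def z'_def mult.assoc orth hk g h k kh
  have "g + h = 1" by (simp add: h_def)
  then have "b * k * c = (g + h) * (b * k * c) * (g + h)" by simp
  also have "\<dots> = y * z + g * (b * k * c) * h + h * (b * k * c) * g + y' * z'"
    by (simp add: rules distrib_left distrib_right)
  finally have split: "b * k * c = y * z + g * (b * k * c) * h + h * (b * k * c) * g + y' * z'" .
  have 1: "C (T (y * z)) = 0" by (rule commutes_T_product[OF g]) (simp_all add: rules)
  have 2: "C (T (y' * z')) = 0" by (rule commutes_T_product[OF h(1)]) (simp_all add: rules)
  have 3: "C (T (g * (b * k * c) * h)) = 0"
    by (rule commutes_T_offdiagonal[OF g]) (simp_all add: rules)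
  have 4: "C (T (h * (b * k * c) * g)) = 0"
    by (rule commutes_T_offdiagonal[OF h(1)]) (simp_all add: rules)
  show ?case by (subst split) (simp only: T.add C_add 1 2 3 4 add_0)
next
  case (mult_map_add f f')
  then show ?case by (simp add: T.add C_add)
qed

text \<open>Let $\epsilon A$ be the largest ideal with $[a, T(\epsilon A)] = 0$. It contains
  $gA(1-g)$ for every idempotent $g$, so the idempotents of $(1-\epsilon)A$ are central. There a
  nonzero value of the nilpotent derivation $[a, \cdot]$ would produce $Y$ with $[a,Y] = g$ a
  nonzero central idempotent, whose fourth iterate at $Y^4$ is $24g$.\<close>

lemma a_center: "a \<in> center"
proof -
  define I where "I = {k. \<forall>m. mult_map m \<longrightarrow> C (T (m k)) = 0}"
  have I: "ideal I"
    unfolding ideal_def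
  proof (intro conjI ballI allI subspaceI)
    show "0 \<in> I" by (simp add: I_def mult_map_zero_arg T.zero C_def)
    show "\<And>x y. x \<in> I \<Longrightarrow> y \<in> I \<Longrightarrow> x + y \<in> I"
      by (simp add: I_def mult_map_plus T.add C_add)
    show "\<And>c x. x \<in> I \<Longrightarrow> scale c x \<in> I"
      by (simp add: I_def mult_map_scale T.scale C_scale)
    fix x y assume x: "x \<in> I"
    have "C (T (m (x * y))) = 0" "C (T (m (y * x))) = 0" if "mult_map m" for m
      using x mult_map_comp[OF that mult_map_right[of y]] mult_map_comp[OF that mult_map_left[of y]]
      by (auto simp: I_def)
    then show "x * y \<in> I" "y * x \<in> I" by (simp_all add: I_def)
  qed
  obtain \<epsilon> where \<epsilon>: "\<epsilon> \<in> I" "\<epsilon> \<in> center" and unit: "\<And>x. x \<in> I \<Longrightarrow> \<epsilon> * x = x"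
    using ideal_unit[OF I] by blast
  have C\<epsilon>: "C (\<epsilon> * w) = 0" for w
  proof -
    obtain x where "T x = w" using T_surj by blast
    moreover have "C (T (\<epsilon> * x)) = 0" using \<epsilon>(1) mult_map_right[of x] by (auto simp: I_def)
    ultimately show ?thesis using T_center[OF \<epsilon>(2)] by simp
  qed
  have C_center: "C (z * w) = z * C w" if "z \<in> center" for z w
  proof -
    have "a * (z * w) = z * (a * w)" by (simp only: mult.assoc[symmetric] centerD[OF that, of a])
    then show ?thesis by (simp add: C_def algebra_simps)
  qed
  have idem_central: "g \<in> center" if g: "g * g = g" and \<epsilon>g: "\<epsilon> * g = 0" for g
  proof (rule centerI)
    fix x
    define h where "h = 1 - g"
    have h: "h * h = h" "g * h = 0" "h * g = 0" using g by (simp_all add: h_def algebra_simps)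
    have g\<epsilon>: "g * \<epsilon> = 0" using \<epsilon>g centerD[OF \<epsilon>(2), of g] by simp
    have "g * x * h \<in> I"
      unfolding I_def using commutes_T_generated[OF g, of "g * x * h"] g h
      by (simp add: mult.assoc) (simp add: mult.assoc[symmetric])
    then have "\<epsilon> * (g * x * h) = g * x * h" by (rule unit)
    then have 1: "g * x * h = 0" using \<epsilon>g by (simp add: mult.assoc[symmetric])
    have "h * x * g \<in> I"
      unfolding I_def using commutes_T_generated[OF h(1), of "h * x * g"] g h
      by (simp add: mult.assoc) (simp add: mult.assoc[symmetric])
    then have "\<epsilon> * (h * x * g) = h * x * g" by (rule unit)
    then have 2: "h * x * g = 0" using g\<epsilon> centerD[OF \<epsilon>(2), of "h * x * g"] by (simp add: mult.assoc)
    have "g * x = g * x * g" using 1 by (simp add: h_def right_diff_distrib)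
    moreover have "x * g = g * x * g" using 2 by (simp add: h_def left_diff_distrib)
    ultimately show "g * x = x * g" by simp
  qed
  have "C y = 0" for y
  proof (rule ccontr)
    assume "C y \<noteq> 0"
    define y0 where "y0 = y - \<epsilon> * y"
    have \<epsilon>\<epsilon>: "\<epsilon> * \<epsilon> = \<epsilon>" using unit \<epsilon>(1) by blast
    have y0: "\<epsilon> * y0 = 0" "C y0 \<noteq> 0"
      using \<open>C y \<noteq> 0\<close> by (simp_all add: y0_def C_diff C\<epsilon> right_diff_distrib mult.assoc[symmetric] \<epsilon>\<epsilon>)
    have \<epsilon>C: "\<epsilon> * C w = 0" if "\<epsilon> * w = 0" for w
      using C_center[OF \<epsilon>(2), of w] that by (simp add: C_def)
    \<comment> \<open>By nilpotence some iterate of C on \<open>y0\<close> is the last but one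
      before zero; its image under C is a nonzero element commuting with a.\<close>
    have "\<exists>y. \<epsilon> * y = 0 \<and> C y \<noteq> 0 \<and> C (C y) = 0"
    proof (cases "C (C y0) = 0")
      case True
      then show ?thesis using y0 by blast
    next
      case ne: False
      show ?thesis
      proof (cases "C (C (C y0)) = 0")
        case True
        then show ?thesis using ne y0 \<epsilon>C by blast
      next
        case False
        then show ?thesis using C_nilpotent[of y0] y0 \<epsilon>C by blast
      qed
    qed
    then obtain y1 where y1: "\<epsilon> * y1 = 0" "C y1 \<noteq> 0" "C (C y1) = 0" by blast
    define b where "b = C y1"
    obtain c where c: "b * c \<noteq> 0" "(b * c) * (b * c) = b * c"
      using right_mult_idempotent y1(2) b_def by metis
    define g where "g = b * c"
    have gg: "g * g = g" "g \<noteq> 0" using c by (simp_all add: g_def)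
    have "\<epsilon> * g = 0" using \<epsilon>C[OF y1(1)] by (simp add: g_def b_def mult.assoc[symmetric])
    then have g: "g \<in> center" using idem_central gg by blast
    define b1 c1 where "b1 = g * b" and "c1 = g * c"
    have gb: "g * b1 = b1" "b1 * g = b1" "g * c1 = c1" "c1 * g = c1"
    proof -
      have "g * (g * w) = g * w" for w by (simp only: mult.assoc[symmetric] gg(1))
      then show "g * b1 = b1" "g * c1 = c1" by (simp_all only: b1_def c1_def)
      then show "b1 * g = b1" "c1 * g = c1" using centerD[OF g] by simp_all
    qed
    have "b1 * c1 = (b1 * g) * c" by (simp only: c1_def mult.assoc)
    also have "\<dots> = g * (b * c)" by (simp only: gb) (simp only: b1_def mult.assoc)
    finally have bc: "b1 * c1 = g" using gg by (simp add: g_def[symmetric])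
    \<comment> \<open>The one-sided inverse of \<open>b1\<close> in gA is two-sided:
      \<open>c1 * b1\<close> is idempotent, hence central, and can be moved past
      \<open>b1\<close>.\<close>
    have "(c1 * b1) * (c1 * b1) = c1 * (b1 * c1) * b1" by (simp add: mult.assoc)
    then have hh: "(c1 * b1) * (c1 * b1) = c1 * b1" using bc gb by simp
    have "\<epsilon> * (c1 * b1) = (\<epsilon> * g) * (c1 * b1)" using gb by (simp add: mult.assoc) (simp add: mult.assoc[symmetric] gb)
    then have "c1 * b1 \<in> center" using idem_central hh \<open>\<epsilon> * g = 0\<close> by simp
    note h = centerD[OF this]
    have "g = (b1 * c1) * (b1 * c1)" using bc gg by simp
    also have "\<dots> = b1 * (c1 * b1) * c1" by (simp only: mult.assoc)
    also have "\<dots> = (c1 * b1) * b1 * c1" using h[of b1] by simp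
    also have "\<dots> = c1 * b1 * g" using bc by (simp add: mult.assoc)
    finally have cb: "c1 * b1 = g" using gb by (simp add: mult.assoc)
    have Cg: "C g = 0" using centerD[OF g, of a] by (simp add: C_def)
    have Cb1: "C b1 = 0" using y1(3) C_center[OF g] by (simp add: b1_def b_def)
    then have ab: "a * b1 = b1 * a" by (simp add: C_def)
    have "c1 * a = (c1 * g) * a" by (simp only: gb)
    also have "\<dots> = c1 * a * g" by (simp only: mult.assoc centerD[OF g, of a])
    also have "\<dots> = c1 * (a * b1) * c1" using bc by (simp add: mult.assoc)
    also have "\<dots> = (c1 * b1) * a * c1" by (simp add: ab mult.assoc)
    also have "\<dots> = a * c1" unfolding cb centerD[OF g, of a] by (simp only: mult.assoc gb)
    finally have Cc1: "C c1 = 0" by (simp add: C_def)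
    \<comment> \<open>Dividing the component of \<open>y1\<close> in gA by its own derivative
      \<open>b1\<close>, whose inverse \<open>c1\<close> is also killed by C, normalises the
      derivative to \<open>g\<close>.\<close>
    define Y where "Y = c1 * (g * y1)"
    have gY: "g * Y = Y" using gb by (simp add: Y_def mult.assoc[symmetric])
    have Yg: "Y * g = Y" using gY centerD[OF g, of Y] by simp
    have CY: "C Y = g"
      using Cc1 C_center[OF g, of y1] cb by (simp add: Y_def C_mult b1_def b_def[symmetric])
    have CY2: "C (Y * Y) = scale 2 Y" by (simp add: C_mult CY gY Yg scale_two)
    have gYY: "g * (Y * w) = Y * w" for w using gY by (simp add: mult.assoc[symmetric])
    have CY3: "C (Y * (Y * Y)) = scale 3 (Y * Y)"
      unfolding C_mult[of Y "Y * Y"] CY CY2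
      by (simp add: gYY scale_mult_right[symmetric] scale_two scale_three add.assoc distrib_left)
    have CY4: "C (Y * (Y * (Y * Y))) = scale 4 (Y * (Y * Y))"
    proof -
      have "scale 4 w = scale (1 + 3) w" for w by simp
      then show ?thesis
        unfolding C_mult[of Y "Y * (Y * Y)"] CY CY3
        by (simp only: gYY scale_mult_right[symmetric] scale_left_distrib scale_one)
    qed
    have "scale 4 (scale 3 (scale 2 g)) = 0"
      using C_nilpotent[of "Y * (Y * (Y * Y))"] by (simp only: CY4 CY3 CY2 CY C_scale)
    moreover have "(4::'k) \<noteq> 0" using two by (metis mult_2 mult_eq_0_iff numeral_Bit0)
    ultimately have "g = 0" using two three by (simp only: scale_eq_0_iff) blast
    then show False using gg by blast
  qed
  then show ?thesis by (intro centerI) (simp add: C_def)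
qed

theorem cubic_preserver_jordan:
  "\<exists>J \<alpha>. jordan_automorphism scale J \<and> in_mult_algebra J \<and>
    \<alpha> \<in> center \<and> \<alpha> ^ 3 = 1 \<and> (\<forall>x. T x = \<alpha> * J x)"
proof -
  define J where "J x = e * T x" for x
  have e_center: "e \<in> center"
  proof (rule centerI)
    fix x
    have "e * x = e * (x * a) * e" using a_e by (simp add: mult.assoc)
    also have "\<dots> = (e * a) * x * e" by (simp add: centerD[OF a_center, of x, symmetric] mult.assoc)
    finally show "e * x = x * e" using e_a by simp
  qed
  have T_J: "T x = a * J x" for x using a_e by (simp add: J_def mult.assoc[symmetric])
  have mJ: "mult_map J"
    unfolding J_def by (rule mult_map_comp[OF mult_map_left T_mult_map])
  have lin: "Vector_Spaces.linear scale scale J"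
    by unfold_locales (simp_all add: mult_map_plus[OF mJ] mult_map_scale[OF mJ])
  have prod: "T x * T y + T y * T x = a * T (x * y + y * x)" for x y
  proof -
    have "A w = scale 2 (a * w)" for w by (simp add: A_def scale_two centerD[OF a_center, of w])
    then have "scale 2 (T x * T y + T y * T x) = scale 2 (a * T (x * y + y * x))"
      by (simp only: star)
    then show ?thesis using two scale_cancel_left by blast
  qed
  have jordan: "J (x * y + y * x) = J x * J y + J y * J x" for x y
  proof -
    have "J u * J v = e * (e * (T u * T v))" for u v
    proof -
      have "J u * J v = e * (T u * e) * T v" by (simp add: J_def mult.assoc)
      then show ?thesis by (simp add: centerD[OF e_center, of "T u", symmetric] mult.assoc)
    qed
    then have "J x * J y + J y * J x = e * (e * (T x * T y + T y * T x))" by (simp add: distrib_left)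
    also have "\<dots> = e * ((e * a) * T (x * y + y * x))" by (simp only: prod mult.assoc)
    finally show ?thesis by (simp add: e_a J_def)
  qed
  have "inj J"
  proof (rule injI)
    fix x y assume "J x = J y"
    then have "T x = T y" by (simp only: T_J)
    then have "T (x - y) = 0" by (simp add: T.diff)
    then have "x - y = 0" by (rule T_kernel)
    then show "x = y" by simp
  qed
  moreover have "surj J"
  proof (rule surjI)
    fix y
    show "J (SOME x. T x = a * y) = y"
      using someI_ex[OF T_surj[of "a * y"]] e_a by (simp add: J_def mult.assoc[symmetric])
  qed
  ultimately have aut: "jordan_automorphism scale J"
    unfolding jordan_automorphism_def bij_def using lin jordan by blast
  have a3: "a ^ 3 = 1"
  proof -
    have a3c: "a * a * a \<in> center" using a_center center_mult by blast
    \<comment> \<open>Trilinearity at (1, 1, z) gives a^3 J z ~ z, whereas J z ~ z gives a^3 J z ~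
      a^3 z.\<close>
    have "a * a * a - 1 = 0"
    proof (rule nondegenerate)
      fix z
      have "(T 1 * T 1 + T 1 * T 1) * T z - (1 * 1 + 1 * 1) * z \<in> K" by (rule T_trilinear)
      moreover have "(T 1 * T 1 + T 1 * T 1) * T z - (1 * 1 + 1 * 1) * z
          = (a * a * a * J z - z) + (a * a * a * J z - z)"
      proof -
        have "a * a * T z = a * a * a * J z" by (simp only: T_J mult.assoc)
        moreover have "(T 1 * T 1 + T 1 * T 1) * T z - (1 * 1 + 1 * 1) * z
          = (a * a * T z + a * a * T z) - (z + z)"
          by (simp only: a_def distrib_right mult_1_left)
        ultimately show ?thesis by simp
      qed
      ultimately have "(a * a * a * J z - z) + (a * a * a * J z - z) \<in> K" by simp
      then have 1: "a * a * a * J z - z \<in> K" by (rule K_half)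
      have 2: "a * a * a * (J z - z) \<in> K"
        by (rule K_center[OF a3c jordan_mod_commutators[OF aut mJ]])
      have "(a * a * a - 1) * z = (a * a * a * J z - z) - a * a * a * (J z - z)"
        by (simp add: algebra_simps)
      then show "(a * a * a - 1) * z \<in> K" using K_diff[OF 1 2] by simp
    qed
    then show ?thesis by (simp add: power3_eq_cube)
  qed
  show ?thesis using aut mJ[unfolded mult_map_iff] a_center a3 T_J by blast
qed

end

lemma jordan_cubic_preserver:
  assumes J: "jordan_automorphism scale J" and M: "in_mult_algebra J"
    and \<alpha>: "\<alpha> \<in> center" "\<alpha> ^ 3 = 1"
  shows "(\<alpha> * J x) ^ 3 - x ^ 3 \<in> K"
proof -
  have "(\<alpha> * J x) ^ 3 = \<alpha> ^ 3 * J x ^ 3"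
  proof -
    have "J x * (\<alpha> * w) = \<alpha> * (J x * w)" for w
      by (simp only: mult.assoc[symmetric] centerD[OF \<alpha>(1), of "J x"])
    then show ?thesis by (simp add: power3_eq_cube mult.assoc)
  qed
  then have "(\<alpha> * J x) ^ 3 = J (x ^ 3)" using \<alpha>(2) J_power[OF J] by simp
  then show ?thesis using jordan_mod_commutators[OF J M[folded mult_map_iff]] by simp
qed

end

text \<open>If xAx = 0, any product of two elements of the ideal generated by x contains a factor x
  w x, so the ideal has square zero.\<close>

lemma (in fd_algebra) semiprime_if_semisimple:
  fixes x :: 'a
  assumes "semisimple_algebra scale" and x: "\<And>y. x * y * x = 0"
  shows "x = 0"
proof -
  define I where "I = {m x | m. mult_map m}"
  have mem: "m x \<in> I" if "mult_map m" for m using that I_def by blast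
  have "alg_ideal scale I"
    using generated_ideal[of x] unfolding I_def alg_ideal_def ideal_def by blast
  moreover have "nilpotent_set I"
    unfolding nilpotent_set_def
  proof (intro exI[of _ 2] conjI allI impI)
    fix xs assume xs: "length xs = 2 \<and> set xs \<subseteq> I"
    then obtain u v where uv: "xs = [u, v]" by (auto simp: numeral_2_eq_2 length_Suc_conv)
    then obtain m m' where m: "mult_map m" "u = m x" and m': "mult_map m'" "v = m' x"
      using xs unfolding I_def by auto
    have zero: "x * (w * m' x) = 0" for w
      using m'(1)
    proof (induction arbitrary: w)
      case (mult_map_base a b)
      have "x * (w * (a * x * b)) = (x * (w * a) * x) * b" by (simp only: mult.assoc)
      then show ?case by (simp only: x mult_zero_left)
    qed (simp only: distrib_left add_0)
    have "m x * m' x = 0"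
      using m(1) by induction (simp_all add: mult.assoc distrib_right zero)
    then show "prod_list xs = 0" using uv m(2) m'(2) by simp
  qed simp
  ultimately have "I = {0}" using assms(1) unfolding semisimple_algebra_def by blast
  then show "x = 0" using mem[OF mult_map_id] by blast
qed

theorem theorem3p3:
  fixes scale :: "'k::field \<Rightarrow> 'a::ring_1 \<Rightarrow> 'a"
    and T :: "'a \<Rightarrow> 'a"
  assumes "fin_dim_algebra scale"
    and "semisimple_algebra scale"
    and "(2::'k) \<noteq> 0" and "(3::'k) \<noteq> 0"
    and "Vector_Spaces.linear scale scale T"
  shows "(\<forall>x. T x ^ 3 - x ^ 3 \<in> commutator_span scale) \<longleftrightarrow>
         (\<exists>J \<alpha>. jordan_automorphism scale J \<and> in_mult_algebra J \<and>
                \<alpha> \<in> center \<and> \<alpha> ^ 3 = 1 \<and> (\<forall>x. T x = \<alpha> * J x))"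
proof -
  have alg: "is_algebra scale" and fd: "\<exists>B. finite B \<and> module.span scale B = UNIV"
    using assms(1) by (simp_all add: fin_dim_algebra_def)
  interpret vector_space scale using alg by (simp add: is_algebra_def)
  obtain B where B: "finite B" "span B = UNIV" using fd by blast
  obtain Basis where Basis: "Basis \<subseteq> B" "independent Basis" "B \<subseteq> span Basis"
    using maximal_independent_subset[of B] by blast
  have Basis_span: "span Basis = UNIV" using span_mono[OF Basis(3)] B(2) by (simp add: span_span top_unique)
  have Basis_finite: "finite Basis" using Basis(1) B(1) by (rule finite_subset)
  have left: "scale c (x * y) = scale c x * y" and right: "scale c (x * y) = x * scale c y" for c x y
    using alg unfolding is_algebra_def by blast+
  interpret fd_algebra scale Basis
    by unfold_locales (fact Basis_finite Basis(2) Basis_span left right)+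
  interpret semiprime_algebra_23 scale Basis
    using semiprime_if_semisimple[OF assms(2)] assms(3,4) by unfold_locales blast+
  show ?thesis
    using cubic_preserver_jordan[OF assms(5)] jordan_cubic_preserver by metis
qed

end
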